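(* Let $\rho\in\{4,5,6,7,8,9,10\}$, let $E=\mathbf e_{\rho-1}+\mathbf e_\rho$, and let $\Gamma_\rho$, $\mathcal E_1$, $\mathcal E_1^*$, $\mathcal K_\rho$, $\mathcal K'_\rho$ and $\mathcal A_{\rho,E}$ be as defined in the context. Then $\mathcal K'_\rho=\mathcal K_\rho$, and the configuration $\mathcal A_{\rho,E}$ of hyperspheres in $\partial\mathcal H_E\cong\mathbb R^{\rho-2}$ has the following properties: (a) The hyperspheres of $\mathcal A_{\rho,E}$ do not intersect or intersect tangentially; that is, for distinct $\mathbf n,\mathbf m\in\mathcal E_1^*$ the open sides $B_{\mathbf n}$ and $B_{\mathbf m}$ are disjoint. (b) The hyperspheres of $\mathcal A_{\rho,E}$ fill $\mathbb R^{\rho-2}$; that is, there is no $\mathbf n\in\mathbb R^{\rho}$ with $\mathbf n\odot\mathbf n>0$ such that $B_{\mathbf n}\cap B_{\mathbf m}=\emptyset$ for every $\mathbf m\in\mathcal E_1^*$. (d) Every hypersphere in $\mathcal A_{\rho,E}$ is a member of a cluster of $\rho$ mutually tangent hyperspheres of $\mathcal A_{\rho,E}$; that is, for every $\mathbf n\in\mathcal E_1^*$ there are $\rho$ distinct elements of $\mathcal E_1^*$, one of which is $\mathbf n$, such that any two distinct ones $\mathbf a,\mathbf b$ among them satisfy $\mathbf a\odot\mathbf b=-1$.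
   Context: Form and hyperbolic space. Let $\mathbf e_1,\dots,\mathbf e_\rho$ be the standard basis of $\mathbb R^\rho$ and let $\odot$ be the symmetric bilinear form with $\mathbf e_i\odot\mathbf e_i=1$ and $\mathbf e_i\odot\mathbf e_j=-1$ for $i\ne j$, i.e. $\mathbf x\odot\mathbf y=2\sum_i x_iy_i-(\sum_i x_i)(\sum_i y_i)$. It has signature $(\rho-1,1)$. Let $D=\mathbf e_1+\dots+\mathbf e_\rho$ (so $D\odot D<0$), $\Lambda=\Lambda_\rho=\mathbb Z\mathbf e_1\oplus\dots\oplus\mathbb Z\mathbf e_\rho$, and $\mathcal H=\{\mathbf x:\mathbf x\odot\mathbf x=-1,\ \mathbf x\odot D<0\}$, a model of hyperbolic space $\mathbb H^{\rho-1}$. Its boundary is $\partial\mathcal H=\mathcal L^+/\mathbb R^+$, where $\mathcal L^+=\{\mathbf x\neq 0:\mathbf x\odot\mathbf x=0,\ \mathbf x\odot D<0\}$. Hyperplanes and hyperspheres. For $\mathbf n$ with $\mathbf n\odot\mathbf n>0$, let $H_{\mathbf n}=\{\mathbf x\in\mathcal H:\mathbf n\odot\mathbf x=0\}$, $H_{\mathbf n}^+=\{\mathbf x\in\mathcal H:\mathbf n\odot\mathbf x\ge 0\}$, $H_{\mathbf n}^-=\{\mathbf x\in\mathcal H:\mathbf n\odot\mathbf x\le 0\}$. With $E=\mathbf e_{\rho-1}+\mathbf e_\rho\in\mathcal L^+$, the set $\partial\mathcal H_E=\partial\mathcal H\setminus\{E\mathbb R^+\}$ with the metric $|AB|_E^2=\frac{-2A\odot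 B}{(A\odot E)(B\odot E)}$ is a model of Euclidean space $\mathbb R^{\rho-2}$, and $H_{\mathbf n,E}=\{\mathbf x\in\partial\mathcal H_E:\mathbf n\odot\mathbf x=0\}$ is a hypersphere in it (a $(\rho-3)$-sphere, or a hyperplane if $\mathbf n\odot E=0$). The open side associated to it is $B_{\mathbf n}=\{\mathbf x\in\partial\mathcal H_E:\mathbf n\odot\mathbf x>0\}$. Two hyperspheres given by vectors $\mathbf a,\mathbf b$ with $\mathbf a\odot\mathbf a=\mathbf b\odot\mathbf b=1$ are tangent with disjoint open sides exactly when $\mathbf a\odot\mathbf b=-1$ (parallel hyperplanes are regarded as tangent at the point at infinity $E$). The configuration. Let $\mathcal E_1=\{\mathbf n\in\Lambda:\mathbf n\odot\mathbf n=1,\ \mathbf n\odot D<0\}$ and $\mathcal K_\rho=\bigcap_{\mathbf n\in\mathcal E_1}H_{\mathbf n}^-$. Let $\mathcal E_1^*$ be the set of $\mathbf n\in\mathcal E_1$ such that $H_{\mathbf n}$ is a face of the polyhedron $\mathcal K_\rho$ (i.e. $H_{\mathbf n}\cap\mathcal K_\rho$ has nonempty interior in $H_{\mathbf n}$). Put $\mathcal A_{\rho,E}=\{H_{\mathbf n,E}:\mathbf n\in\mathcal E_1^*\}$. The group $\Gamma_\rho$. For $\mathbf n\odot\mathbf n>0$ let $R_{\mathbf n}(\mathbf x)=\mathbf x-2\frac{\mathbf n\odot\mathbf x}{\mathbf n\odot\mathbf n}\mathbf n$. For linearly independent $P,Q\in\mathcal L^+$ let $\phi_{P,Q}(\mathbf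 x)=\frac{2((P\odot\mathbf x)Q+(Q\odot\mathbf x)P)}{P\odot Q}-\mathbf x$. Write $\mathbf v_{ij}=\mathbf e_i-\mathbf e_j$ and $\mathbf u=\mathbf e_1-\mathbf e_{\rho-2}+\mathbf e_{\rho-1}+\mathbf e_\rho$. Coordinates are with respect to $\mathbf e_1,\dots,\mathbf e_\rho$. - For $4\le\rho\le 8$, $\Gamma_\rho$ is generated by $R_{\mathbf v_{i,i+1}}$ ($1\le i\le\rho-3$), $R_{\mathbf u}$, $R_{\mathbf v_{\rho-1,\rho}}$ and $R_{\mathbf v_{1,\rho-1}}$. - For $\rho=9$, $\Gamma_9$ is generated by the reflections $R_{\mathbf v_{i,i+1}}$ ($1\le i\le 6$), $R_{\mathbf u}$, $R_{\mathbf v_{89}}$, $R_{\mathbf v_{18}}$, together with $\phi_{P_1,E}$ and $\phi_{P_1,P_2}$, where $P_1=(1,1,1,1,0,-1,-1,1,1)$ and $P_2=(1,1,1,1,2,-1,-2,1,2)$. - For $\rho=10$, $\Gamma_{10}$ is generated by the reflections $R_{\mathbf v_{i,i+1}}$ ($1\le i\le 7$), $R_{\mathbf u}$, $R_{\mathbf v_{9,10}}$, $R_{\mathbf v_{19}}$, $R_{\mathbf n}$ with $\mathbf n=(1,1,1,1,1,-1,-1,-1,1,1)$, together with $\phi_{P_1,E}$ and $\phi_{P_1,P_2}$, where $P_1=(1,1,1,1,0,0,-1,-1,1,1)$ and $P_2=(1,1,1,1,2,2,-1,-3,1,3)$. Finally $\mathcal K'_\rho=\bigcap_{\gamma\in\Gamma_\rho}H^-_{\gamma\mathbf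 e_\rho}$. *)

theory Defs
  imports
    "HOL-Analysis.Analysis"
    "HOL-Library.Function_Algebras"
    "HOL-Algebra.Bij"
    "HOL-Algebra.Generated_Groups"
begin

text \<open>
  The dimension \<open>\<rho>\<close> is a natural number that enters the coordinates of the generators of the
  group below, so \<open>\<real>\<^sup>\<rho>\<close> is represented by the functions \<open>nat \<Rightarrow> real\<close> supported on \<open>{1..\<rho>}\<close>, with
  pointwise addition. The product topology of \<open>nat \<Rightarrow> real\<close> induces the Euclidean topology there.
\<close>

definition coord_space :: "nat \<Rightarrow> (nat \<Rightarrow> real) set" where
  "coord_space \<rho> = {x. \<forall>i. i \<notin> {1..\<rho>} \<longrightarrow> x i = 0}"

definition bvec :: "nat \<Rightarrow> nat \<Rightarrow> real" where
  "bvec i = (\<lambda>k. if k = i then 1 else 0)"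

text \<open>The vector with coordinates \<open>xs\<close> with respect to \<open>bvec 1, \<dots>, bvec (length xs)\<close>.\<close>

definition coords :: "real list \<Rightarrow> nat \<Rightarrow> real" where
  "coords xs = (\<lambda>k. if k \<in> {1..length xs} then xs ! (k - 1) else 0)"

definition lform :: "nat \<Rightarrow> (nat \<Rightarrow> real) \<Rightarrow> (nat \<Rightarrow> real) \<Rightarrow> real" where
  "lform \<rho> x y = 2 * (\<Sum>i=1..\<rho>. x i * y i) - (\<Sum>i=1..\<rho>. x i) * (\<Sum>i=1..\<rho>. y i)"

lemma lform_bvec:
  assumes "i \<in> {1..\<rho>}" "j \<in> {1..\<rho>}"
  shows "lform \<rho> (bvec i) (bvec j) = (if i = j then 1 else - 1)"
proof -
  have "(\<Sum>k=1..\<rho>. bvec i k) = 1" "(\<Sum>k=1..\<rho>. bvec j k) = 1"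
    using assms by (auto simp: bvec_def)
  moreover have "(\<Sum>k=1..\<rho>. bvec i k * bvec j k) = (\<Sum>k=1..\<rho>. if k = i then bvec j i else 0)"
    by (rule sum.cong) (auto simp: bvec_def)
  ultimately show ?thesis
    using assms by (auto simp: lform_def bvec_def)
qed

definition Dvec :: "nat \<Rightarrow> nat \<Rightarrow> real" where
  "Dvec \<rho> = (\<Sum>i=1..\<rho>. bvec i)"

definition Evec :: "nat \<Rightarrow> nat \<Rightarrow> real" where
  "Evec \<rho> = bvec (\<rho> - 1) + bvec \<rho>"

definition lattice :: "nat \<Rightarrow> (nat \<Rightarrow> real) set" where
  "lattice \<rho> = {x \<in> coord_space \<rho>. \<forall>i. x i \<in> \<int>}"

definition hyp :: "nat \<Rightarrow> (nat \<Rightarrow> real) set" where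
  "hyp \<rho> = {x \<in> coord_space \<rho>. lform \<rho> x x = - 1 \<and> lform \<rho> x (Dvec \<rho>) < 0}"

definition light_cone :: "nat \<Rightarrow> (nat \<Rightarrow> real) set" where
  "light_cone \<rho> = {x \<in> coord_space \<rho>. x \<noteq> 0 \<and> lform \<rho> x x = 0 \<and> lform \<rho> x (Dvec \<rho>) < 0}"

definition ray_rel :: "nat \<Rightarrow> ((nat \<Rightarrow> real) \<times> (nat \<Rightarrow> real)) set" where
  "ray_rel \<rho> = {(x, y) \<in> light_cone \<rho> \<times> light_cone \<rho>. \<exists>t>0. y = (\<lambda>i. t * x i)}"

lemma equiv_ray_rel: "equiv (light_cone \<rho>) (ray_rel \<rho>)"
proof (rule equivI)
  show "ray_rel \<rho> \<subseteq> light_cone \<rho> \<times> light_cone \<rho>"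
    by (auto simp: ray_rel_def)
  show "refl_on (light_cone \<rho>) (ray_rel \<rho>)"
    by (auto simp: refl_on_def ray_rel_def intro!: exI[of _ "1::real"])
  show "sym (ray_rel \<rho>)"
  proof (rule symI)
    fix x y assume "(x, y) \<in> ray_rel \<rho>"
    then obtain t where t: "t > 0" "y = (\<lambda>i. t * x i)" "x \<in> light_cone \<rho>" "y \<in> light_cone \<rho>"
      by (auto simp: ray_rel_def)
    then have "inverse t > 0" "x = (\<lambda>i. inverse t * y i)"
      by (auto simp: field_simps)
    then show "(y, x) \<in> ray_rel \<rho>"
      using t(3,4) unfolding ray_rel_def by blast
  qed
  show "trans (ray_rel \<rho>)"
  proof (rule transI)
    fix x y z assume "(x, y) \<in> ray_rel \<rho>" "(y, z) \<in> ray_rel \<rho>"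
    then obtain s t where st: "s > 0" "t > 0" "y = (\<lambda>i. s * x i)" "z = (\<lambda>i. t * y i)"
      "x \<in> light_cone \<rho>" "z \<in> light_cone \<rho>"
      by (auto simp: ray_rel_def)
    then have "t * s > 0" "z = (\<lambda>i. (t * s) * x i)"
      by (auto simp: mult.assoc)
    then show "(x, z) \<in> ray_rel \<rho>"
      using st(5,6) unfolding ray_rel_def by blast
  qed
qed

text \<open>The boundary of hyperbolic space; its points are rays.\<close>

definition bdry :: "nat \<Rightarrow> (nat \<Rightarrow> real) set set" where
  "bdry \<rho> = light_cone \<rho> // ray_rel \<rho>"

definition bdryE :: "nat \<Rightarrow> (nat \<Rightarrow> real) set set" where
  "bdryE \<rho> = bdry \<rho> - {ray_rel \<rho> `` {Evec \<rho>}}"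

definition Hplane :: "nat \<Rightarrow> (nat \<Rightarrow> real) \<Rightarrow> (nat \<Rightarrow> real) set" where
  "Hplane \<rho> n = {x \<in> hyp \<rho>. lform \<rho> n x = 0}"

definition Hminus :: "nat \<Rightarrow> (nat \<Rightarrow> real) \<Rightarrow> (nat \<Rightarrow> real) set" where
  "Hminus \<rho> n = {x \<in> hyp \<rho>. lform \<rho> n x \<le> 0}"

text \<open>The sign of \<open>lform \<rho> n\<close> is constant on each ray.\<close>

definition open_side :: "nat \<Rightarrow> (nat \<Rightarrow> real) \<Rightarrow> (nat \<Rightarrow> real) set set" where
  "open_side \<rho> n = {X \<in> bdryE \<rho>. \<forall>x\<in>X. lform \<rho> n x > 0}"

definition E1 :: "nat \<Rightarrow> (nat \<Rightarrow> real) set" where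
  "E1 \<rho> = {n \<in> lattice \<rho>. lform \<rho> n n = 1 \<and> lform \<rho> n (Dvec \<rho>) < 0}"

definition K :: "nat \<Rightarrow> (nat \<Rightarrow> real) set" where
  "K \<rho> = (\<Inter>n\<in>E1 \<rho>. Hminus \<rho> n)"

text \<open>The interior in the definition of a face is taken relative to the hyperplane.\<close>

definition E1_star :: "nat \<Rightarrow> (nat \<Rightarrow> real) set" where
  "E1_star \<rho> = {n \<in> E1 \<rho>. top_of_set (Hplane \<rho> n) interior_of (Hplane \<rho> n \<inter> K \<rho>) \<noteq> {}}"

definition reflection :: "nat \<Rightarrow> (nat \<Rightarrow> real) \<Rightarrow> (nat \<Rightarrow> real) \<Rightarrow> nat \<Rightarrow> real" where
  "reflection \<rho> n x = (\<lambda>i. x i - 2 * (lform \<rho> n x / lform \<rho> n n) * n i)"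

definition phi :: "nat \<Rightarrow> (nat \<Rightarrow> real) \<Rightarrow> (nat \<Rightarrow> real) \<Rightarrow> (nat \<Rightarrow> real) \<Rightarrow> nat \<Rightarrow> real" where
  "phi \<rho> P Q x = (\<lambda>i. 2 * (lform \<rho> P x * Q i + lform \<rho> Q x * P i) / lform \<rho> P Q - x i)"

definition gens_common :: "nat \<Rightarrow> ((nat \<Rightarrow> real) \<Rightarrow> nat \<Rightarrow> real) set" where
  "gens_common \<rho> =
     {reflection \<rho> (bvec i - bvec (i + 1)) | i. 1 \<le> i \<and> i \<le> \<rho> - 3}
     \<union> {reflection \<rho> (bvec 1 - bvec (\<rho> - 2) + bvec (\<rho> - 1) + bvec \<rho>),
        reflection \<rho> (bvec (\<rho> - 1) - bvec \<rho>),
        reflection \<rho> (bvec 1 - bvec (\<rho> - 1))}"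

definition gens_extra :: "nat \<Rightarrow> ((nat \<Rightarrow> real) \<Rightarrow> nat \<Rightarrow> real) set" where
  "gens_extra \<rho> =
     (if \<rho> = 9 then
        (let P1 = coords [1, 1, 1, 1, 0, -1, -1, 1, 1];
             P2 = coords [1, 1, 1, 1, 2, -1, -2, 1, 2]
         in {phi \<rho> P1 (Evec \<rho>), phi \<rho> P1 P2})
      else if \<rho> = 10 then
        (let n = coords [1, 1, 1, 1, 1, -1, -1, -1, 1, 1];
             P1 = coords [1, 1, 1, 1, 0, 0, -1, -1, 1, 1];
             P2 = coords [1, 1, 1, 1, 2, 2, -1, -3, 1, 3]
         in {reflection \<rho> n, phi \<rho> P1 (Evec \<rho>), phi \<rho> P1 P2})
      else {})"

text \<open>
  The group generated inside the group of all bijections of \<open>coord_space \<rho>\<close>, whose elements are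
  extensional functions; hence the restriction. For \<open>4 \<le> \<rho> \<le> 10\<close> every generator restricts to an
  involution of \<open>coord_space \<rho>\<close>, so it lies in that group.
\<close>

definition Gamma :: "nat \<Rightarrow> ((nat \<Rightarrow> real) \<Rightarrow> nat \<Rightarrow> real) set" where
  "Gamma \<rho> = generate (BijGroup (coord_space \<rho>))
     ((\<lambda>g. restrict g (coord_space \<rho>)) ` (gens_common \<rho> \<union> gens_extra \<rho>))"

definition K' :: "nat \<Rightarrow> (nat \<Rightarrow> real) set" where
  "K' \<rho> = (\<Inter>\<gamma>\<in>Gamma \<rho>. Hminus \<rho> (\<gamma> (bvec \<rho>)))"

end

theory Submission
  imports Defs
begin

text \<open>
  The form takes odd integer values on pairs in \<open>\<E>\<^sub>1\<close>, so any two of the hyperplanes are disjoint or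
  tangent, and the sides away from \<open>D\<close> are disjoint or nested. A nested side is detected by
  \<open>n - m\<close> lying in the closed forward light cone, and the outermost sides are exactly the members
  of \<open>\<E>\<^sub>1\<^sup>*\<close>; this gives (a) and \<open>\<K> = \<Inter>\<^sub>n H\<^sub>n\<^sup>-\<close> over \<open>\<E>\<^sub>1\<^sup>*\<close>. For (b), norm one vectors obtained from
  Eichler transvections accumulate at every rational boundary point.

  Each generator of \<open>\<Gamma>\<^sub>\<rho>\<close> is an integral involutive isometry with a fixed point inside \<open>\<K>\<close>, hence it
  preserves \<open>\<E>\<^sub>1\<^sup>*\<close>. Conversely every \<open>n \<in> \<E>\<^sub>1\<^sup>*\<close> is in the orbit of \<open>\<e>\<^sub>\<rho>\<close>: among the orbit of \<open>n\<close> take a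
  member closest to a suitable point \<open>w\<close> inside \<open>\<K>\<close>. It satisfies linear inequalities bounding a
  polyhedral cone that, once truncated by \<open>\<e>\<^sub>\<rho>\<close>, lies in the closed light cone; as \<open>n \<odot> n = 1\<close>, the
  member is \<open>\<e>\<^sub>\<rho>\<close> itself. So \<open>\<K>' = \<K>\<close>, and (d) is the transported cluster \<open>\<e>\<^sub>1, \<dots>, \<e>\<^sub>\<rho>\<close>.
\<close>

section \<open>The Lorentz form\<close>

text \<open>The obstacle is rho = 9, 10. There the chamber of the roots in
  \<open>gens_common\<close>, even truncated by e_rho, has vertices outside the light cone, and the
  maps phi have no mirrors that could cut them off: they fix the plane of P and Q and act as -1 on
  its orthogonal complement. Therefore minimality is measured against the orbit of w and not against
  walls. Every reachable w' yields the linear inequality (w' - w) . n \<le> 0, whatever element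
  produced it, and suitable w' are mirror images of w in the missing walls.

  Being inside K is an infinite condition. It becomes finite because Cauchy-Schwarz bounds the
  coordinate sum of any m in E1 that has the given point on its nonnegative side.

  That the truncated cone lies in the light cone is certified by an identity: the negative of the
  form is a sum of products of linear forms that are nonnegative on the cone.\<close>

definition csum :: "nat \<Rightarrow> (nat \<Rightarrow> real) \<Rightarrow> real" where
  "csum \<rho> x = (\<Sum>i=1..\<rho>. x i)"

definition sqsum :: "nat \<Rightarrow> (nat \<Rightarrow> real) \<Rightarrow> real" where
  "sqsum \<rho> x = (\<Sum>i=1..\<rho>. (x i)\<^sup>2)"

lemma lform_self: "lform \<rho> x x = 2 * sqsum \<rho> x - (csum \<rho> x)\<^sup>2"
  by (simp add: lform_def csum_def sqsum_def power2_eq_square)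

lemma lform_commute: "lform \<rho> x y = lform \<rho> y x"
  by (simp add: lform_def mult.commute)

lemma csum_simps:
  "csum \<rho> (x + y) = csum \<rho> x + csum \<rho> y"
  "csum \<rho> (x - y) = csum \<rho> x - csum \<rho> y"
  "csum \<rho> (- x) = - csum \<rho> x"
  "csum \<rho> (\<lambda>i. a * x i) = a * csum \<rho> x"
  "csum \<rho> (\<lambda>i. x i * a) = csum \<rho> x * a"
  "csum \<rho> (\<lambda>i. x i + y i) = csum \<rho> x + csum \<rho> y"
  "csum \<rho> (\<lambda>i. x i - y i) = csum \<rho> x - csum \<rho> y"
  by (simp_all add: csum_def sum.distrib sum_subtractf sum_negf sum_distrib_left
      sum_distrib_right)

lemma lform_simps:
  "lform \<rho> (x + y) z = lform \<rho> x z + lform \<rho> y z"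
  "lform \<rho> (x - y) z = lform \<rho> x z - lform \<rho> y z"
  "lform \<rho> (- x) z = - lform \<rho> x z"
  "lform \<rho> (\<lambda>i. a * x i) z = a * lform \<rho> x z"
  "lform \<rho> (\<lambda>i. x i + y i) z = lform \<rho> x z + lform \<rho> y z"
  "lform \<rho> (\<lambda>i. x i - y i) z = lform \<rho> x z - lform \<rho> y z"
  "lform \<rho> z (x + y) = lform \<rho> z x + lform \<rho> z y"
  "lform \<rho> z (x - y) = lform \<rho> z x - lform \<rho> z y"
  "lform \<rho> z (- x) = - lform \<rho> z x"
  "lform \<rho> z (\<lambda>i. a * x i) = a * lform \<rho> z x"
  "lform \<rho> (\<lambda>i. x i * a) z = a * lform \<rho> x z"
  "lform \<rho> z (\<lambda>i. x i * a) = a * lform \<rho> z x"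
  "lform \<rho> (\<lambda>i. x i / b) z = lform \<rho> x z / b"
  "lform \<rho> z (\<lambda>i. x i / b) = lform \<rho> z x / b"
  "lform \<rho> z (\<lambda>i. x i + y i) = lform \<rho> z x + lform \<rho> z y"
  "lform \<rho> z (\<lambda>i. x i - y i) = lform \<rho> z x - lform \<rho> z y"
proof -
  have *: "(\<Sum>i=1..\<rho>. a * x i * z i) = a * (\<Sum>i=1..\<rho>. x i * z i)"
    "(\<Sum>i=1..\<rho>. z i * (a * x i)) = a * (\<Sum>i=1..\<rho>. z i * x i)"
    "(\<Sum>i=1..\<rho>. a * x i) = a * (\<Sum>i=1..\<rho>. x i)" for a and x z :: "nat \<Rightarrow> real"
    by (simp_all add: sum_distrib_left algebra_simps)
  show 1:
    "lform \<rho> (\<lambda>i. a * x i) z = a * lform \<rho> x z"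
    "lform \<rho> z (\<lambda>i. a * x i) = a * lform \<rho> z x" for a
    unfolding lform_def * by (simp_all add: algebra_simps)
  show
    "lform \<rho> (\<lambda>i. x i * a) z = a * lform \<rho> x z"
    "lform \<rho> z (\<lambda>i. x i * a) = a * lform \<rho> z x"
    "lform \<rho> (\<lambda>i. x i / b) z = lform \<rho> x z / b"
    "lform \<rho> z (\<lambda>i. x i / b) = lform \<rho> z x / b"
    using 1[of a] 1[of "1 / b"] by (simp_all add: mult.commute)
qed (simp_all add: lform_def sum.distrib sum_subtractf sum_negf algebra_simps)

lemma coord_space_simps:
  "x \<in> coord_space \<rho> \<Longrightarrow> y \<in> coord_space \<rho> \<Longrightarrow> x + y \<in> coord_space \<rho>"
  "x \<in> coord_space \<rho> \<Longrightarrow> y \<in> coord_space \<rho> \<Longrightarrow> x - y \<in> coord_space \<rho>"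
  "x \<in> coord_space \<rho> \<Longrightarrow> - x \<in> coord_space \<rho>"
  "x \<in> coord_space \<rho> \<Longrightarrow> (\<lambda>i. a * x i) \<in> coord_space \<rho>"
  "x \<in> coord_space \<rho> \<Longrightarrow> y \<in> coord_space \<rho> \<Longrightarrow> (\<lambda>i. x i + y i) \<in> coord_space \<rho>"
  "x \<in> coord_space \<rho> \<Longrightarrow> y \<in> coord_space \<rho> \<Longrightarrow> (\<lambda>i. x i - y i) \<in> coord_space \<rho>"
  by (auto simp: coord_space_def)

lemma Dvec_eq: "Dvec \<rho> = (\<lambda>k. if k \<in> {1..\<rho>} then 1 else 0)"
proof
  fix k
  have "(\<Sum>i\<in>A. bvec i) k = (\<Sum>i\<in>A. bvec i k)" if "finite A" for A :: "nat set"
    using that by (induction A) auto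
  then have "Dvec \<rho> k = (\<Sum>i=1..\<rho>. bvec i k)"
    by (simp add: Dvec_def)
  also have "\<dots> = (if k \<in> {1..\<rho>} then 1 else 0)"
    by (simp add: bvec_def)
  finally show "Dvec \<rho> k = (if k \<in> {1..\<rho>} then 1 else 0)" .
qed

lemma Dvec_in: "Dvec \<rho> \<in> coord_space \<rho>"
  by (auto simp: Dvec_eq coord_space_def)

lemma csum_Dvec: "csum \<rho> (Dvec \<rho>) = real \<rho>"
  by (simp add: csum_def Dvec_eq)

text \<open>For rho \<ge> 3 the factor is negative, so the coordinate sum can replace D as time
  coordinate in all that follows.\<close>

lemma lform_Dvec: "lform \<rho> x (Dvec \<rho>) = (2 - real \<rho>) * csum \<rho> x"
  using csum_Dvec[of \<rho>] by (simp add: lform_def csum_def Dvec_eq algebra_simps)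

lemma lform_Dvec_neg_iff: "\<rho> \<ge> 3 \<Longrightarrow> lform \<rho> x (Dvec \<rho>) < 0 \<longleftrightarrow> csum \<rho> x > 0"
  by (simp add: lform_Dvec mult_less_0_iff)

lemma bvec_in: "i \<in> {1..\<rho>} \<Longrightarrow> bvec i \<in> coord_space \<rho>"
  by (auto simp: coord_space_def bvec_def)

lemma csum_bvec: "i \<in> {1..\<rho>} \<Longrightarrow> csum \<rho> (bvec i) = 1"
  by (simp add: csum_def bvec_def)

lemma lform_bvec_left: "i \<in> {1..\<rho>} \<Longrightarrow> lform \<rho> (bvec i) x = 2 * x i - csum \<rho> x"
proof -
  assume i: "i \<in> {1..\<rho>}"
  have "(\<Sum>k=1..\<rho>. bvec i k * x k) = (\<Sum>k=1..\<rho>. if k = i then x k else 0)"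
    by (rule sum.cong) (auto simp: bvec_def)
  with i csum_bvec[OF i] show ?thesis by (simp add: lform_def csum_def)
qed

text \<open>The form is twice the Euclidean product minus the product of the time coordinates. For
  causal vectors this bound on the Euclidean part becomes the reversed Cauchy-Schwarz
  inequality.\<close>

lemma lform_cauchy:
  "(lform \<rho> x y + csum \<rho> x * csum \<rho> y)\<^sup>2 \<le> (2 * sqsum \<rho> x) * (2 * sqsum \<rho> y)"
  using Cauchy_Schwarz_ineq_sum[of x y "{1..\<rho>}"]
  by (simp add: lform_def csum_def sqsum_def power_mult_distrib)

lemma sqsum_nonneg: "sqsum \<rho> x \<ge> 0"
  by (simp add: sqsum_def sum_nonneg)

lemma sqsum_eq_0D: "sqsum \<rho> x = 0 \<Longrightarrow> x \<in> coord_space \<rho> \<Longrightarrow> x = 0"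
proof
  fix k
  assume "sqsum \<rho> x = 0" "x \<in> coord_space \<rho>"
  then have "\<forall>i\<in>{1..\<rho>}. (x i)\<^sup>2 = 0" "k \<notin> {1..\<rho>} \<longrightarrow> x k = 0"
    by (simp_all add: sqsum_def sum_nonneg_eq_0_iff coord_space_def)
  then show "x k = 0 k" by (cases "k \<in> {1..\<rho>}") auto
qed

section \<open>Causal vectors and time orientation\<close>

definition causal :: "nat \<Rightarrow> (nat \<Rightarrow> real) \<Rightarrow> bool" where
  "causal \<rho> x \<longleftrightarrow> lform \<rho> x x \<le> 0 \<and> csum \<rho> x \<ge> 0"

definition timelike :: "nat \<Rightarrow> (nat \<Rightarrow> real) \<Rightarrow> bool" where
  "timelike \<rho> x \<longleftrightarrow> lform \<rho> x x < 0 \<and> csum \<rho> x > 0"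

lemma timelike_causal: "timelike \<rho> x \<Longrightarrow> causal \<rho> x"
  by (simp add: timelike_def causal_def)

lemma causal_lform_le:
  assumes "causal \<rho> x" "causal \<rho> y"
  shows "lform \<rho> x y \<le> 0"
proof -
  have "(2 * sqsum \<rho> x) * (2 * sqsum \<rho> y) \<le> (csum \<rho> x)\<^sup>2 * (csum \<rho> y)\<^sup>2"
    using assms sqsum_nonneg by (intro mult_mono) (auto simp: causal_def lform_self)
  with lform_cauchy[of \<rho> x y]
  have "(lform \<rho> x y + csum \<rho> x * csum \<rho> y)\<^sup>2 \<le> (csum \<rho> x * csum \<rho> y)\<^sup>2"
    by (simp add: power_mult_distrib)
  then have "lform \<rho> x y + csum \<rho> x * csum \<rho> y \<le> csum \<rho> x * csum \<rho> y"
    by (rule power2_le_imp_le) (use assms in \<open>simp add: causal_def\<close>)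
  then show ?thesis by simp
qed

lemma causal_csum_pos:
  assumes "causal \<rho> x" "x \<in> coord_space \<rho>" "x \<noteq> 0"
  shows "csum \<rho> x > 0"
proof (rule ccontr)
  assume "\<not> ?thesis"
  with assms(1) have "csum \<rho> x = 0" by (simp add: causal_def)
  with assms(1) have "sqsum \<rho> x \<le> 0" by (simp add: causal_def lform_self)
  then have "sqsum \<rho> x = 0" using sqsum_nonneg[of \<rho> x] by linarith
  with assms show False using sqsum_eq_0D by blast
qed

lemma timelike_lform_less:
  assumes "timelike \<rho> x" "causal \<rho> y" "y \<in> coord_space \<rho>" "y \<noteq> 0"
  shows "lform \<rho> x y < 0"
proof -
  have y: "csum \<rho> y > 0" using causal_csum_pos assms by blast
  have "sqsum \<rho> y \<noteq> 0" using sqsum_eq_0D assms by blast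
  then have "sqsum \<rho> y > 0" using sqsum_nonneg[of \<rho> y] by linarith
  moreover have "2 * sqsum \<rho> y \<le> (csum \<rho> y)\<^sup>2" "2 * sqsum \<rho> x < (csum \<rho> x)\<^sup>2"
    using assms by (auto simp: causal_def timelike_def lform_self)
  ultimately have "(2 * sqsum \<rho> x) * (2 * sqsum \<rho> y) < (csum \<rho> x)\<^sup>2 * (csum \<rho> y)\<^sup>2"
    using sqsum_nonneg[of \<rho> x] y by (intro mult_less_le_imp_less) auto
  with lform_cauchy[of \<rho> x y]
  have "(lform \<rho> x y + csum \<rho> x * csum \<rho> y)\<^sup>2 < (csum \<rho> x * csum \<rho> y)\<^sup>2"
    by (simp add: power_mult_distrib)
  then have "lform \<rho> x y + csum \<rho> x * csum \<rho> y < csum \<rho> x * csum \<rho> y"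
    by (rule power2_less_imp_less) (use assms in \<open>simp add: causal_def timelike_def\<close>)
  then show ?thesis by simp
qed

text \<open>Time orientation can be tested against any timelike vector. The symmetries treated later
  fix such a vector but need not fix D.\<close>

lemma causalI_timelike:
  assumes "timelike \<rho> q" "x \<in> coord_space \<rho>" "lform \<rho> x x \<le> 0" "lform \<rho> x q \<le> 0"
  shows "causal \<rho> x"
proof (rule ccontr)
  assume "\<not> ?thesis"
  with assms have neg: "csum \<rho> x < 0" by (simp add: causal_def)
  then have "- x \<noteq> 0" by (auto simp: csum_def)
  moreover have "causal \<rho> (- x)"
    using neg assms by (simp add: causal_def lform_simps csum_simps)
  ultimately have "lform \<rho> q (- x) < 0"
    using timelike_lform_less assms(1,2) coord_space_simps(3) by blast
  with assms(4) show False by (simp add: lform_simps lform_commute)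
qed

lemma timelikeI_timelike:
  assumes "timelike \<rho> q" "x \<in> coord_space \<rho>" "lform \<rho> x x < 0" "lform \<rho> x q \<le> 0"
  shows "timelike \<rho> x"
proof -
  have c: "causal \<rho> x" using causalI_timelike assms by simp
  have "x \<noteq> 0" using assms(3) by (auto simp: lform_def)
  then show ?thesis using causal_csum_pos c assms by (simp add: timelike_def)
qed

lemma causal_add:
  assumes "causal \<rho> x" "causal \<rho> y"
  shows "causal \<rho> (x + y)"
  using assms causal_lform_le[OF assms]
  by (simp add: causal_def lform_simps csum_simps lform_commute[of \<rho> y x])

lemma Dvec_timelike: "\<rho> \<ge> 3 \<Longrightarrow> timelike \<rho> (Dvec \<rho>)"
  by (simp add: timelike_def lform_Dvec csum_Dvec mult_less_0_iff)

lemma hyp_iff: "\<rho> \<ge> 3 \<Longrightarrow> x \<in> hyp \<rho> \<longleftrightarrow> x \<in> coord_space \<rho> \<and> lform \<rho> x x = -1 \<and> timelike \<rho> x"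
  by (auto simp: hyp_def lform_Dvec_neg_iff timelike_def)

lemma light_cone_iff:
  "\<rho> \<ge> 3 \<Longrightarrow> x \<in> light_cone \<rho> \<longleftrightarrow> x \<in> coord_space \<rho> \<and> x \<noteq> 0 \<and> lform \<rho> x x = 0 \<and> causal \<rho> x"
  using causal_csum_pos by (auto simp: light_cone_def lform_Dvec_neg_iff causal_def)

section \<open>Nested and outermost sides\<close>

lemma E1_iff:
  "\<rho> \<ge> 3 \<Longrightarrow> n \<in> E1 \<rho> \<longleftrightarrow> n \<in> lattice \<rho> \<and> lform \<rho> n n = 1 \<and> csum \<rho> n > 0"
  by (simp add: E1_def lform_Dvec_neg_iff)

lemma lattice_coord_space: "x \<in> lattice \<rho> \<Longrightarrow> x \<in> coord_space \<rho>"
  by (simp add: lattice_def)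

lemma lattice_csum: "x \<in> lattice \<rho> \<Longrightarrow> csum \<rho> x \<in> \<int>"
  unfolding csum_def lattice_def by (intro Ints_sum) auto

lemma lattice_lform: "x \<in> lattice \<rho> \<Longrightarrow> y \<in> lattice \<rho> \<Longrightarrow> lform \<rho> x y \<in> \<int>"
  unfolding lform_def lattice_def
  by (intro Ints_diff Ints_mult Ints_sum) auto

text \<open>If k is the coordinate sum of a norm one vector, 2 q - k^2 = 1 makes k odd; the form of
  two such vectors is an even number minus an odd product. No sign is assumed, because images under
  symmetries are considered before their sign is known.\<close>

lemma lform_odd:
  assumes "n \<in> lattice \<rho>" "m \<in> lattice \<rho>" "lform \<rho> n n = 1" "lform \<rho> m m = 1"
  shows "\<exists>k::int. odd k \<and> csum \<rho> n = of_int k" "\<exists>k::int. odd k \<and> lform \<rho> n m = of_int k"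
proof -
  have A: "\<exists>k::int. odd k \<and> csum \<rho> n = of_int k"
    if "n \<in> lattice \<rho>" "lform \<rho> n n = 1" for n
  proof -
    have "csum \<rho> n \<in> \<int>" "sqsum \<rho> n \<in> \<int>"
      using that(1) lattice_csum unfolding sqsum_def lattice_def by (auto intro!: Ints_sum)
    then obtain k :: int where k: "csum \<rho> n = of_int k" by (auto elim: Ints_cases)
    from \<open>sqsum \<rho> n \<in> \<int>\<close> obtain q :: int where q: "sqsum \<rho> n = of_int q" by (auto elim: Ints_cases)
    have "2 * of_int q - (of_int k)\<^sup>2 = (1::real)"
      using that(2) by (simp add: lform_self k q)
    then have "2 * q - k\<^sup>2 = 1"
      using of_int_eq_iff[of "2 * q - k\<^sup>2" 1, where ?'a = real] by simp
    then have "k\<^sup>2 = 2 * (q - 1) + 1" by simp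
    then have "odd (k\<^sup>2)" by simp
    then have "odd k" by simp
    with k show ?thesis by blast
  qed
  show "\<exists>k::int. odd k \<and> csum \<rho> n = of_int k" using A assms by blast
  obtain k l :: int where kl: "odd k" "odd l" "csum \<rho> n = of_int k" "csum \<rho> m = of_int l"
    using A assms by meson
  have "(\<Sum>i=1..\<rho>. n i * m i) \<in> \<int>"
    using assms(1,2) unfolding lattice_def by (intro Ints_sum Ints_mult) auto
  then obtain p :: int where "(\<Sum>i=1..\<rho>. n i * m i) = of_int p" by (auto elim: Ints_cases)
  then have "lform \<rho> n m = of_int (2 * p - k * l)"
    using kl by (simp add: lform_def csum_def)
  moreover have "odd (2 * p - k * l)" using kl by simp
  ultimately show "\<exists>k::int. odd k \<and> lform \<rho> n m = of_int k" by blast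
qed

lemma E1_coord_space: "n \<in> E1 \<rho> \<Longrightarrow> n \<in> coord_space \<rho>"
  by (simp add: E1_def lattice_coord_space)

lemma E1_csum_ge_1:
  assumes "\<rho> \<ge> 3" "n \<in> E1 \<rho>"
  shows "csum \<rho> n \<ge> 1"
proof -
  have n: "n \<in> lattice \<rho>" "lform \<rho> n n = 1" "csum \<rho> n > 0" using assms by (auto simp: E1_iff)
  obtain k :: int where "csum \<rho> n = of_int k" using lform_odd(1)[OF n(1,1,2,2)] by blast
  with n show ?thesis by simp
qed

lemma E1_lform_dichotomy:
  assumes "\<rho> \<ge> 3" "n \<in> E1 \<rho>" "m \<in> E1 \<rho>"
  shows "lform \<rho> n m \<le> -1 \<or> lform \<rho> n m \<ge> 1"
proof -
  obtain k :: int where k: "odd k" "lform \<rho> n m = of_int k"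
    using lform_odd(2)[of n \<rho> m] assms by (auto simp: E1_iff)
  then have "k \<noteq> 0" by auto
  then consider "k \<le> -1" | "k \<ge> 1" by linarith
  then show ?thesis by cases (simp_all add: k(2))
qed

text \<open>The norm of \<open>n - m\<close> is 2 - 2 (n . m). Once it is causal, n . x \<le> m . x
  for causal x, so the positive side of n lies in that of m: the smaller coordinate sum has the
  larger side.\<close>

lemma E1_nested:
  assumes "\<rho> \<ge> 3" "n \<in> E1 \<rho>" "m \<in> E1 \<rho>" "lform \<rho> n m \<ge> 1" "csum \<rho> m \<le> csum \<rho> n"
  shows "causal \<rho> (n - m)"
  using assms lform_commute[of \<rho> m n] by (auto simp: causal_def lform_simps csum_simps E1_iff)

lemma E1_disjoint:
  assumes "\<rho> \<ge> 3" "n \<in> E1 \<rho>" "m \<in> E1 \<rho>" "lform \<rho> n m \<le> -1"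
  shows "causal \<rho> (n + m)"
  using assms lform_commute[of \<rho> m n] by (auto simp: causal_def lform_simps csum_simps E1_iff)

lemma causal_null_csum:
  assumes "causal \<rho> x" "x \<in> coord_space \<rho>" "csum \<rho> x = 0"
  shows "x = 0"
  using assms causal_csum_pos by fastforce

lemma bvec_E1:
  assumes "\<rho> \<ge> 3" "i \<in> {1..\<rho>}"
  shows "bvec i \<in> E1 \<rho>"
  using assms csum_bvec lform_bvec[of i \<rho> i] bvec_in[of i \<rho>]
  by (auto simp: E1_iff lattice_def bvec_def)

lemma K_iff: "\<rho> \<ge> 3 \<Longrightarrow> x \<in> K \<rho> \<longleftrightarrow> x \<in> hyp \<rho> \<and> (\<forall>n\<in>E1 \<rho>. lform \<rho> n x \<le> 0)"
  using bvec_E1[of \<rho> 1] by (auto simp: K_def Hminus_def)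

text \<open>Combinatorial form of being a face: any other side meeting that of n belongs to a
  strictly larger coordinate sum, hence is contained in it.\<close>

definition outermost :: "nat \<Rightarrow> (nat \<Rightarrow> real) \<Rightarrow> bool" where
  "outermost \<rho> n \<longleftrightarrow> n \<in> E1 \<rho> \<and>
     (\<forall>m\<in>E1 \<rho>. m \<noteq> n \<longrightarrow> lform \<rho> n m \<le> -1 \<or> csum \<rho> n < csum \<rho> m)"

text \<open>One point x of K on the hyperplane suffices. A nonzero causal \<open>n - m\<close> pairs
  strictly negatively with the timelike x, which would put x on the positive side of m.\<close>

lemma outermostI:
  assumes "\<rho> \<ge> 3" "n \<in> E1 \<rho>" "x \<in> hyp \<rho>" "lform \<rho> n x = 0" "\<forall>m\<in>E1 \<rho>. lform \<rho> m x \<le> 0"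
  shows "outermost \<rho> n"
  unfolding outermost_def
proof (intro conjI ballI impI)
  fix m assume m: "m \<in> E1 \<rho>" "m \<noteq> n"
  show "lform \<rho> n m \<le> -1 \<or> csum \<rho> n < csum \<rho> m"
  proof (rule ccontr)
    assume "\<not> ?thesis"
    then have "causal \<rho> (n - m)"
      using E1_lform_dichotomy E1_nested assms m by (meson not_le)
    moreover have "n - m \<noteq> 0" using m by simp
    moreover have "timelike \<rho> x" using assms by (simp add: hyp_iff)
    ultimately have "lform \<rho> x (n - m) < 0"
      using timelike_lform_less coord_space_simps(2) E1_coord_space assms(2) m by blast
    with assms(4,5) m show False
      by (fastforce simp: lform_simps lform_commute[of \<rho> x])
  qed
qed fact

text \<open>Faces are entire hyperplanes, since every other side is disjoint from that of n or
  contained in it. This makes the relative interior in \<open>E1_star\<close> trivial to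
  compute.\<close>

lemma outermost_Hplane_subset_K:
  assumes "\<rho> \<ge> 3" "outermost \<rho> n" "x \<in> Hplane \<rho> n"
  shows "x \<in> K \<rho>"
proof -
  have x: "x \<in> hyp \<rho>" "lform \<rho> n x = 0" "causal \<rho> x"
    using assms timelike_causal by (auto simp: Hplane_def hyp_iff)
  have n: "n \<in> E1 \<rho>" using assms by (simp add: outermost_def)
  have "lform \<rho> m x \<le> 0" if m: "m \<in> E1 \<rho>" for m
  proof (cases "m = n")
    case False
    have "causal \<rho> (n + m) \<or> causal \<rho> (m - n)"
      using E1_lform_dichotomy[OF assms(1) n m] assms(2) m False
        E1_disjoint[OF assms(1) n m] E1_nested[OF assms(1) m n]
      by (auto simp: outermost_def lform_commute[of \<rho> m])
    then show ?thesis
      using causal_lform_le[OF _ x(3), of "n + m"] causal_lform_le[OF _ x(3), of "m - n"] x(2)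
      by (auto simp: lform_simps)
  qed (use x in simp)
  with assms x show ?thesis by (simp add: K_iff)
qed

lemma Hplane_nonempty:
  assumes "\<rho> \<ge> 3" "n \<in> coord_space \<rho>" "lform \<rho> n n = 1"
  shows "Hplane \<rho> n \<noteq> {}"
proof -
  define d where "d = lform \<rho> n (Dvec \<rho>)"
  \<comment> \<open>Orthogonal projection of D to the hyperplane; removing a spacelike component
    lowers the norm, so it stays timelike.\<close>
  define y where "y = (\<lambda>i. Dvec \<rho> i - d * n i)"
  note D = Dvec_timelike[OF assms(1)]
  have y: "y \<in> coord_space \<rho>"
    unfolding y_def using assms(2) Dvec_in by (intro coord_space_simps)
  have yy: "lform \<rho> y y = lform \<rho> (Dvec \<rho>) (Dvec \<rho>) - d\<^sup>2"
    "lform \<rho> y (Dvec \<rho>) = lform \<rho> (Dvec \<rho>) (Dvec \<rho>) - d\<^sup>2" "lform \<rho> n y = 0"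
    using assms(3)
    by (simp_all add: y_def lform_simps d_def lform_commute[of \<rho> "Dvec \<rho>" n] power2_eq_square)
  have "lform \<rho> y y < 0" "lform \<rho> y (Dvec \<rho>) < 0"
    unfolding yy using D by (simp_all add: timelike_def add_strict_increasing2 less_le_trans[of _ 0])
  define t where "t = 1 / sqrt (- lform \<rho> y y)"
  have "t > 0" "t * t * lform \<rho> y y = -1"
    using \<open>lform \<rho> y y < 0\<close> by (simp_all add: t_def divide_simps)
  then have "(\<lambda>i. t * y i) \<in> Hplane \<rho> n"
    using y yy(3) \<open>lform \<rho> y (Dvec \<rho>) < 0\<close>
    by (simp add: Hplane_def hyp_def lform_simps coord_space_simps mult.assoc mult_less_0_iff)
  then show ?thesis by blast
qed

lemma E1_star_iff_outermost:
  assumes "\<rho> \<ge> 3"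
  shows "n \<in> E1_star \<rho> \<longleftrightarrow> outermost \<rho> n"
proof
  assume "n \<in> E1_star \<rho>"
  then have n: "n \<in> E1 \<rho>" "Hplane \<rho> n \<inter> K \<rho> \<noteq> {}"
    using interior_of_subset by (fastforce simp: E1_star_def)+
  then obtain x where "x \<in> Hplane \<rho> n" "x \<in> K \<rho>" by blast
  with n(1) assms outermostI show "outermost \<rho> n"
    by (auto simp: K_iff Hplane_def)
next
  assume n: "outermost \<rho> n"
  then have "n \<in> coord_space \<rho>" "lform \<rho> n n = 1" "n \<in> E1 \<rho>"
    using assms by (auto simp: outermost_def E1_iff lattice_coord_space)
  moreover have "Hplane \<rho> n \<inter> K \<rho> = Hplane \<rho> n"
    using outermost_Hplane_subset_K[OF assms n] by blast
  moreover have "top_of_set (Hplane \<rho> n) interior_of (Hplane \<rho> n) = Hplane \<rho> n"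
    by (metis interior_of_topspace topspace_euclidean_subtopology)
  ultimately show "n \<in> E1_star \<rho>"
    using Hplane_nonempty assms by (simp add: E1_star_def)
qed

lemma E1_star_iff:
  assumes "\<rho> \<ge> 3"
  shows "n \<in> E1_star \<rho> \<longleftrightarrow>
    n \<in> E1 \<rho> \<and> (\<exists>x\<in>hyp \<rho>. lform \<rho> n x = 0 \<and> (\<forall>m\<in>E1 \<rho>. lform \<rho> m x \<le> 0))"
proof
  assume "n \<in> E1_star \<rho>"
  then have n: "n \<in> E1 \<rho>" "Hplane \<rho> n \<inter> K \<rho> \<noteq> {}"
    using interior_of_subset by (fastforce simp: E1_star_def)+
  then show "n \<in> E1 \<rho> \<and> (\<exists>x\<in>hyp \<rho>. lform \<rho> n x = 0 \<and> (\<forall>m\<in>E1 \<rho>. lform \<rho> m x \<le> 0))"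
    using assms by (auto simp: K_iff Hplane_def)
qed (use assms outermostI E1_star_iff_outermost in blast)

lemma E1_star_E1: "n \<in> E1_star \<rho> \<Longrightarrow> n \<in> E1 \<rho>"
  by (simp add: E1_star_def)

lemma E1_star_lform_le:
  assumes "\<rho> \<ge> 3" "n \<in> E1_star \<rho>" "m \<in> E1_star \<rho>" "n \<noteq> m"
  shows "lform \<rho> n m \<le> -1"
  using assms lform_commute[of \<rho> n m] by (fastforce simp: E1_star_iff_outermost outermost_def)

text \<open>The coordinate sum 1 is the least possible in E1. A side containing that of a basis
  vector would give a causal difference with time coordinate 0, which is the zero vector.\<close>

lemma bvec_E1_star:
  assumes "\<rho> \<ge> 3" "i \<in> {1..\<rho>}"
  shows "bvec i \<in> E1_star \<rho>"
proof -
  have "lform \<rho> (bvec i) m \<le> -1 \<or> csum \<rho> (bvec i) < csum \<rho> m"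
    if m: "m \<in> E1 \<rho>" "m \<noteq> bvec i" for m
  proof (rule ccontr)
    assume "\<not> ?thesis"
    then have *: "lform \<rho> m (bvec i) \<ge> 1" "csum \<rho> m \<le> 1"
      using E1_lform_dichotomy[OF assms(1) bvec_E1[OF assms] m(1)] csum_bvec[OF assms(2)]
      by (auto simp: lform_commute)
    then have s: "csum \<rho> m = csum \<rho> (bvec i)"
      using E1_csum_ge_1[OF assms(1) m(1)] csum_bvec[OF assms(2)] by simp
    then have "causal \<rho> (m - bvec i)"
      using E1_nested[OF assms(1) m(1) bvec_E1[OF assms]] * by simp
    then have "m - bvec i = 0"
      by (rule causal_null_csum)
        (use s m E1_coord_space bvec_in[OF assms(2)] in
          \<open>simp_all add: csum_simps coord_space_simps\<close>)
    with m show False by simp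
  qed
  with assms bvec_E1 show ?thesis by (auto simp: E1_star_iff_outermost outermost_def)
qed

text \<open>Each passage to a larger side lowers the positive integer \<open>csum\<close>, so the
  process ends, and the causal differences add up.\<close>

lemma E1_star_above:
  assumes "\<rho> \<ge> 3" "n \<in> E1 \<rho>"
  shows "\<exists>m\<in>E1_star \<rho>. causal \<rho> (n - m)"
  using assms(2)
proof (induction "nat \<lfloor>csum \<rho> n\<rfloor>" arbitrary: n rule: less_induct)
  case less
  show ?case
  proof (cases "outermost \<rho> n")
    case True
    then have "n \<in> E1_star \<rho>" using E1_star_iff_outermost assms by blast
    moreover have "causal \<rho> (n - n)" by (simp add: causal_def csum_def lform_def)
    ultimately show ?thesis by blast
  next
    case False
    then obtain m where m: "m \<in> E1 \<rho>" "m \<noteq> n" "\<not> lform \<rho> n m \<le> -1" "csum \<rho> m \<le> csum \<rho> n"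
      using less.prems by (auto simp: outermost_def not_less)
    then have nm: "causal \<rho> (n - m)"
      using E1_nested E1_lform_dichotomy assms(1) less.prems by blast
    have "csum \<rho> m \<noteq> csum \<rho> n"
      using causal_null_csum[OF nm] m E1_coord_space less.prems
      by (auto simp: csum_simps coord_space_simps)
    then have "csum \<rho> m < csum \<rho> n" using m by simp
    moreover have "csum \<rho> m \<in> \<int>" "csum \<rho> n \<in> \<int>"
      using lattice_csum m less.prems by (auto simp: E1_def)
    ultimately have "nat \<lfloor>csum \<rho> m\<rfloor> < nat \<lfloor>csum \<rho> n\<rfloor>"
      using E1_csum_ge_1[OF assms(1) m(1)] by (auto elim!: Ints_cases)
    then obtain k where "k \<in> E1_star \<rho>" "causal \<rho> (m - k)"
      using less.hyps m(1) by blast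
    moreover have "n - k = (n - m) + (m - k)" by simp
    ultimately show ?thesis using causal_add[OF nm] by metis
  qed
qed

lemma K_eq_Inter_E1_star:
  assumes "\<rho> \<ge> 3"
  shows "K \<rho> = (\<Inter>n\<in>E1_star \<rho>. Hminus \<rho> n)"
proof
  show "K \<rho> \<subseteq> (\<Inter>n\<in>E1_star \<rho>. Hminus \<rho> n)"
    using E1_star_E1 by (fastforce simp: K_def)
  show "(\<Inter>n\<in>E1_star \<rho>. Hminus \<rho> n) \<subseteq> K \<rho>"
  proof
    fix x assume x: "x \<in> (\<Inter>n\<in>E1_star \<rho>. Hminus \<rho> n)"
    have "x \<in> hyp \<rho>"
      using x bvec_E1_star[of \<rho> 1] assms by (auto simp: Hminus_def)
    moreover have "lform \<rho> n x \<le> 0" if n: "n \<in> E1 \<rho>" for n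
    proof -
      obtain m where m: "m \<in> E1_star \<rho>" "causal \<rho> (n - m)"
        using E1_star_above assms n by blast
      then have "lform \<rho> (n - m) x \<le> 0" "lform \<rho> m x \<le> 0"
        using x \<open>x \<in> hyp \<rho>\<close> assms timelike_causal causal_lform_le
        by (auto simp: hyp_iff Hminus_def)
      then show ?thesis by (simp add: lform_simps)
    qed
    ultimately show "x \<in> K \<rho>" using assms by (simp add: K_iff)
  qed
qed

lemma open_sides_disjoint:
  assumes "\<rho> \<ge> 3" "n \<in> E1_star \<rho>" "m \<in> E1_star \<rho>" "n \<noteq> m"
  shows "open_side \<rho> n \<inter> open_side \<rho> m = {}"
proof (rule ccontr)
  assume "\<not> ?thesis"
  then obtain X where X: "X \<in> bdry \<rho>" "\<forall>x\<in>X. lform \<rho> n x > 0" "\<forall>x\<in>X. lform \<rho> m x > 0"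
    by (auto simp: open_side_def bdryE_def)
  then obtain x where "x \<in> X" "x \<in> light_cone \<rho>"
    using equiv_ray_rel[of \<rho>]
    by (metis bdry_def equiv_class_self quotientE)
  with X have x: "lform \<rho> n x > 0" "lform \<rho> m x > 0" "causal \<rho> x"
    using assms(1) by (auto simp: light_cone_iff)
  have "causal \<rho> (n + m)"
    using E1_disjoint E1_star_lform_le E1_star_E1 assms by blast
  then have "lform \<rho> (n + m) x \<le> 0" using causal_lform_le x by blast
  with x show False by (simp add: lform_simps)
qed

section \<open>Filling\<close>

lemma Evec_lattice: "\<rho> \<ge> 3 \<Longrightarrow> Evec \<rho> \<in> lattice \<rho>"
  by (auto simp: Evec_def lattice_def coord_space_def bvec_def)

lemma Evec_null: "\<rho> \<ge> 3 \<Longrightarrow> lform \<rho> (Evec \<rho>) (Evec \<rho>) = 0"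
  by (simp add: Evec_def lform_simps lform_bvec)

lemma csum_Evec: "\<rho> \<ge> 3 \<Longrightarrow> csum \<rho> (Evec \<rho>) = 2"
  by (simp add: Evec_def csum_simps csum_bvec)

lemma Evec_causal: "\<rho> \<ge> 3 \<Longrightarrow> causal \<rho> (Evec \<rho>)"
  by (simp add: causal_def Evec_null csum_Evec)

text \<open>This keeps the boundary point constructed in \<open>open_sides_fill\<close> away from
  the removed point at infinity. If k is one of the two summands of E, the pairings 1 and -1
  cancel.\<close>

lemma E1_lform_Evec_le:
  assumes "\<rho> \<ge> 3" "m \<in> E1 \<rho>"
  shows "lform \<rho> m (Evec \<rho>) \<le> 0"
proof -
  obtain k where k: "k \<in> E1_star \<rho>" "causal \<rho> (m - k)"
    using E1_star_above assms by blast
  have e: "bvec (\<rho> - 1) \<in> E1_star \<rho>" "bvec \<rho> \<in> E1_star \<rho>" "bvec \<rho> \<noteq> bvec (\<rho> - 1)"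
    using assms(1) bvec_E1_star by (auto simp: bvec_def fun_eq_iff)
  have "lform \<rho> k (bvec (\<rho> - 1)) + lform \<rho> k (bvec \<rho>) \<le> 0"
  proof (cases "k = bvec \<rho> \<or> k = bvec (\<rho> - 1)")
    case True
    then show ?thesis using assms(1) by (auto simp: lform_bvec)
  next
    case False
    then show ?thesis
      using E1_star_lform_le[OF assms(1) k(1) e(1)] E1_star_lform_le[OF assms(1) k(1) e(2)]
      by auto
  qed
  then have "lform \<rho> k (Evec \<rho>) \<le> 0" by (simp add: Evec_def lform_simps)
  moreover have "lform \<rho> (m - k) (Evec \<rho>) \<le> 0"
    using causal_lform_le k(2) Evec_causal assms(1) by blast
  ultimately show ?thesis by (simp add: lform_simps)
qed

lemma tendsto_lform:
  assumes "\<And>i. ((\<lambda>k. f k i) \<longlongrightarrow> x i) F" "\<And>i. ((\<lambda>k. g k i) \<longlongrightarrow> y i) F"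
  shows "((\<lambda>k. lform \<rho> (f k) (g k)) \<longlongrightarrow> lform \<rho> x y) F"
  unfolding lform_def by (intro tendsto_intros assms)

lemma tendsto_floor_mult_over: "(\<lambda>k. of_int \<lfloor>real k * x\<rfloor> / real k) \<longlonglongrightarrow> (x :: real)"
proof (rule tendsto_sandwich)
  show "\<forall>\<^sub>F k in sequentially. x - 1 / real k \<le> of_int \<lfloor>real k * x\<rfloor> / real k"
    using eventually_gt_at_top[of 0]
  proof eventually_elim
    case (elim k)
    then have "x - 1 / real k = (real k * x - 1) / real k" by (simp add: field_simps)
    also have "\<dots> \<le> of_int \<lfloor>real k * x\<rfloor> / real k"
      using real_of_int_floor_gt_diff_one[of "real k * x"] by (intro divide_right_mono) auto
    finally show ?case .
  qed
  show "\<forall>\<^sub>F k in sequentially. of_int \<lfloor>real k * x\<rfloor> / real k \<le> x"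
    using eventually_gt_at_top[of 0]
  proof eventually_elim
    case (elim k)
    then show ?case by (simp add: field_simps)
  qed
  show "(\<lambda>k. x - 1 / real k) \<longlonglongrightarrow> x"
    using tendsto_diff[OF tendsto_const lim_1_over_n, of x] by simp
qed simp

text \<open>Up to the positive factor \<open>v \<odot> v\<close>, the value at \<open>n\<close> of the reflection of \<open>e\<close> in \<open>v\<close>.\<close>

definition refl_val :: "nat \<Rightarrow> (nat \<Rightarrow> real) \<Rightarrow> (nat \<Rightarrow> real) \<Rightarrow> (nat \<Rightarrow> real) \<Rightarrow> real" where
  "refl_val \<rho> e n v = lform \<rho> v v * lform \<rho> e n - 2 * lform \<rho> v e * lform \<rho> v n"

lemma refl_val_scale: "refl_val \<rho> e n (\<lambda>i. a * v i) = a\<^sup>2 * refl_val \<rho> e n v"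
  by (simp add: refl_val_def lform_simps power2_eq_square algebra_simps)

text \<open>Both conditions are open and survive scaling, so it is enough to clear the denominators
  of a rational approximation.\<close>

lemma lattice_approx:
  assumes "v \<in> coord_space \<rho>" "refl_val \<rho> e n v > 0" "lform \<rho> v e \<noteq> 0"
  obtains z where "z \<in> lattice \<rho>" "refl_val \<rho> e n z > 0" "lform \<rho> z e \<noteq> 0"
proof -
  define z where "z k = (\<lambda>i. of_int \<lfloor>real k * v i\<rfloor> :: real)" for k :: nat
  define u where "u k = (\<lambda>i. z k i / real k)" for k
  have u: "(\<lambda>k. u k i) \<longlonglongrightarrow> v i" for i
    unfolding u_def z_def by (rule tendsto_floor_mult_over)
  have "(\<lambda>k. refl_val \<rho> e n (u k)) \<longlonglongrightarrow> refl_val \<rho> e n v"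
    unfolding refl_val_def by (intro tendsto_intros tendsto_lform u)
  then have "\<forall>\<^sub>F k in sequentially. refl_val \<rho> e n (u k) > 0"
    using assms(2) order_tendstoD(1) by blast
  moreover have "(\<lambda>k. lform \<rho> (u k) e) \<longlonglongrightarrow> lform \<rho> v e"
    by (intro tendsto_intros tendsto_lform u)
  then have "\<forall>\<^sub>F k in sequentially. lform \<rho> (u k) e \<noteq> 0"
    using assms(3) tendsto_imp_eventually_ne by blast
  ultimately have "\<forall>\<^sub>F k in sequentially. refl_val \<rho> e n (u k) > 0 \<and> lform \<rho> (u k) e \<noteq> 0 \<and> k > 0"
    using eventually_gt_at_top[of 0] by eventually_elim auto
  then obtain k where k: "refl_val \<rho> e n (u k) > 0" "lform \<rho> (u k) e \<noteq> 0" "k > 0"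
    using eventually_happens'[OF sequentially_bot] by blast
  have z: "z k = (\<lambda>i. real k * u k i)" using k(3) by (auto simp: u_def)
  show ?thesis
  proof
    show "z k \<in> lattice \<rho>"
      using assms(1) by (auto simp: z_def lattice_def coord_space_def)
    show "refl_val \<rho> e n (z k) > 0" "lform \<rho> (z k) e \<noteq> 0"
      using k unfolding z refl_val_scale by (simp_all add: lform_simps)
  qed
qed

text \<open>Reflecting E in lattice vectors z gives rational null rays. The factor z . z, of either
  sign, clears the denominator; the pairing -2 (z . E)^2 with E shows that the result points forward
  nonetheless.\<close>

lemma exists_lattice_null:
  assumes "\<rho> \<ge> 3" "n \<in> coord_space \<rho>" "lform \<rho> n n > 0"
  obtains p where "p \<in> lattice \<rho>" "lform \<rho> p p = 0" "csum \<rho> p > 0" "lform \<rho> p n > 0"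
proof (cases "lform \<rho> (Evec \<rho>) n > 0")
  case True
  then show ?thesis
    using that[of "Evec \<rho>"] Evec_lattice Evec_null csum_Evec assms(1) by simp
next
  case False
  let ?E = "Evec \<rho>" and ?D = "Dvec \<rho>"
  have "\<exists>v\<in>coord_space \<rho>. refl_val \<rho> ?E n v > 0 \<and> lform \<rho> v ?E \<noteq> 0"
  proof (cases "lform \<rho> ?E n = 0")
    case True
    \<comment> \<open>The reflection in n fixes E when E . n = 0, so n is perturbed by a small
      multiple of D; when E . n < 0, n itself serves as v.\<close>
    define t where "t = lform \<rho> n n / (1 + \<bar>lform \<rho> ?D n\<bar>) "
    have "\<bar>t * lform \<rho> ?D n\<bar> < lform \<rho> n n" "t > 0"
      using assms(3) by (auto simp: t_def abs_mult field_simps add_pos_nonneg)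
    then have pos: "lform \<rho> n n + t * lform \<rho> ?D n > 0" by linarith
    have DE: "lform \<rho> ?D ?E < 0"
      using assms(1) csum_Evec lform_Dvec_neg_iff lform_commute by (metis zero_less_numeral)
    have "refl_val \<rho> ?E n (\<lambda>i. n i + t * ?D i)
        = - 2 * (t * lform \<rho> ?D ?E) * (lform \<rho> n n + t * lform \<rho> ?D n)"
      using True by (simp add: refl_val_def lform_simps lform_commute[of \<rho> n ?E])
    also have "\<dots> > 0"
      using DE pos \<open>t > 0\<close> by (simp add: mult_pos_neg mult_neg_pos mult_less_0_iff)
    finally show ?thesis
      using DE \<open>t > 0\<close> assms(2) Dvec_in True
      by (intro bexI[of _ "\<lambda>i. n i + t * ?D i"] conjI coord_space_simps)
        (simp_all add: lform_simps lform_commute[of \<rho> n ?E])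
  next
    case nonzero: False
    then have "lform \<rho> ?E n < 0" using False by simp
    then show ?thesis
      using assms by (intro bexI[of _ n])
        (simp_all add: refl_val_def lform_commute[of \<rho> n ?E] mult_pos_neg)
  qed
  then obtain z where z: "z \<in> lattice \<rho>" "refl_val \<rho> ?E n z > 0" "lform \<rho> z ?E \<noteq> 0"
    using lattice_approx by metis
  define p where "p = (\<lambda>i. lform \<rho> z z * ?E i - 2 * lform \<rho> z ?E * z i)"
  have pl: "p \<in> lattice \<rho>"
  proof -
    have "lform \<rho> z z \<in> \<int>" "lform \<rho> z ?E \<in> \<int>"
      using lattice_lform z(1) Evec_lattice assms(1) by auto
    then show ?thesis
      using z(1) Evec_lattice[OF assms(1)] by (auto simp: p_def lattice_def coord_space_def)
  qed
  have p: "lform \<rho> p p = 0" "lform \<rho> p n > 0" "lform \<rho> p ?E < 0"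
    using z(2,3) Evec_null[OF assms(1)]
    by (simp_all add: p_def refl_val_def lform_simps lform_commute[of \<rho> ?E z]
        not_sum_power2_lt_zero power2_eq_square[symmetric] mult.assoc)
  have "csum \<rho> p > 0"
  proof (rule ccontr)
    assume "\<not> ?thesis"
    then have "causal \<rho> (- p)" using p(1) by (simp add: causal_def lform_simps csum_simps)
    then have "lform \<rho> (- p) ?E \<le> 0" using causal_lform_le Evec_causal assms(1) by blast
    with p(3) show False by (simp add: lform_simps)
  qed
  with pl p that show ?thesis by blast
qed

lemma quadratic_pos:
  fixes t :: real
  assumes "t \<ge> 1" "A * t > \<bar>B\<bar> + \<bar>C\<bar>"
  shows "A * t\<^sup>2 + B * t + C > 0"
proof -
  have "(\<bar>B\<bar> + \<bar>C\<bar>) * t < A * t * t" using assms by (intro mult_strict_right_mono) auto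
  moreover have "\<bar>C\<bar> \<le> \<bar>C\<bar> * t" using assms by (simp add: mult_le_cancel_left1)
  moreover have "- B * t \<le> \<bar>B\<bar> * t" using assms by (intro mult_right_mono) auto
  moreover have "- C \<le> \<bar>C\<bar>" by simp
  ultimately show ?thesis by (simp add: power2_eq_square algebra_simps)
qed

text \<open>
  The images of \<open>bvec i\<close> under the powers of the Eichler transvection attached to \<open>p\<close> and \<open>w\<close>
  converge to the ray of \<open>p\<close>.
\<close>

lemma exists_E1_near_null:
  assumes "\<rho> \<ge> 3" "p \<in> lattice \<rho>" "lform \<rho> p p = 0" "csum \<rho> p > 0" "lform \<rho> p n > 0"
  obtains m where "m \<in> E1 \<rho>" "lform \<rho> m p < 0" "lform \<rho> m n \<ge> 0"
proof -
  have total: "(\<Sum>j=1..\<rho>. lform \<rho> (bvec j) p) < 0"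
  proof -
    have "(\<Sum>j=1..\<rho>. lform \<rho> (bvec j) p) = (\<Sum>j=1..\<rho>. 2 * p j - csum \<rho> p)"
      by (intro sum.cong refl lform_bvec_left)
    also have "\<dots> = (2 - real \<rho>) * csum \<rho> p"
      by (simp add: sum_subtractf csum_def left_diff_distrib flip: sum_distrib_left)
    also have "\<dots> < 0" using assms by (simp add: mult_less_0_iff)
    finally show ?thesis .
  qed
  then obtain i where i: "i \<in> {1..\<rho>}" "lform \<rho> (bvec i) p < 0"
    by (meson not_le sum_nonneg)
  \<comment> \<open>The vector w below has norm (\<alpha> + \<beta>)^2, which must not vanish. If it
    vanished for all j, the negative total would equal (2 - rho) \<alpha> > 0.\<close>
  have "\<exists>j\<in>{1..\<rho>} - {i}. lform \<rho> (bvec i) p + lform \<rho> (bvec j) p \<noteq> 0"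
  proof (rule ccontr)
    assume "\<not> ?thesis"
    then have "(\<Sum>j\<in>{1..\<rho>} - {i}. lform \<rho> (bvec j) p)
        = (\<Sum>j\<in>{1..\<rho>} - {i}. - lform \<rho> (bvec i) p)"
      by (intro sum.cong) (auto simp: eq_neg_iff_add_eq_0 add.commute)
    also have "\<dots> = (real \<rho> - 1) * - lform \<rho> (bvec i) p"
      using i(1) assms(1) by (simp add: of_nat_diff)
    finally have "(\<Sum>j=1..\<rho>. lform \<rho> (bvec j) p) = (2 - real \<rho>) * lform \<rho> (bvec i) p"
      using sum.remove[of "{1..\<rho>}" i "\<lambda>j. lform \<rho> (bvec j) p"] i(1)
      by (simp add: algebra_simps)
    moreover have "(2 - real \<rho>) * lform \<rho> (bvec i) p > 0"
      using i(2) assms(1) by (simp add: zero_less_mult_iff)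
    ultimately show False using total by linarith
  qed
  then obtain j where j: "j \<in> {1..\<rho>}" "j \<noteq> i" "lform \<rho> (bvec i) p + lform \<rho> (bvec j) p \<noteq> 0"
    by blast
  define \<alpha> \<beta> e where "\<alpha> = lform \<rho> (bvec i) p" and "\<beta> = lform \<rho> (bvec j) p" and "e = bvec i"
  \<comment> \<open>An integral combination of e_i and e_j orthogonal to p, as a transvection
    requires.\<close>
  define w where "w = (\<lambda>k. \<alpha> * bvec j k - \<beta> * e k)"
  define A0 where "A0 = lform \<rho> e w"
  define Q where "Q = - 2 * \<alpha> * (\<alpha> + \<beta>)\<^sup>2"
  have ee: "lform \<rho> e e = 1" and ep: "lform \<rho> e p = \<alpha>" and ij: "lform \<rho> e (bvec j) = -1"
    using i(1) j lform_bvec[of i \<rho> i] lform_bvec[of i \<rho> j] by (simp_all add: e_def \<alpha>_def)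
  have jj: "lform \<rho> (bvec j) (bvec j) = 1" using j lform_bvec[of j \<rho> j] by simp
  have wp: "lform \<rho> w p = 0" by (simp add: w_def lform_simps ep \<beta>_def)
  have ww: "lform \<rho> w w = (\<alpha> + \<beta>)\<^sup>2"
    by (simp add: w_def lform_simps ee ij jj lform_commute[of \<rho> "bvec j" e] power2_eq_square
        algebra_simps)
  have "\<alpha> < 0" "\<alpha> + \<beta> \<noteq> 0" using i(2) j(3) by (simp_all add: \<alpha>_def \<beta>_def)
  then have "Q > 0" by (simp add: Q_def mult_less_0_iff)
  \<comment> \<open>The transvection attached to p and 2 t w; the factor 2 keeps half the norm of 2
    t w integral. Q makes the t^2 terms in the norm cancel.\<close>
  define m where "m t = (\<lambda>k. e k + (2 * t * \<alpha>) * w k + (Q * t\<^sup>2 - 2 * t * A0) * p k)" for t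
  have mm: "lform \<rho> (m t) (m t) = 1" for t
    by (simp add: m_def lform_simps ee ep wp ww assms(3) lform_commute[of \<rho> p e]
        lform_commute[of \<rho> p w] lform_commute[of \<rho> w e] flip: A0_def)
      (simp add: Q_def power2_eq_square algebra_simps)
  have mp: "lform \<rho> (m t) p = \<alpha>" for t
    by (simp add: m_def lform_simps ep wp assms(3))
  have mn: "lform \<rho> (m t) n = (Q * lform \<rho> p n) * t\<^sup>2
      + (2 * \<alpha> * lform \<rho> w n - 2 * A0 * lform \<rho> p n) * t + lform \<rho> e n" for t
    by (simp add: m_def lform_simps) (simp add: algebra_simps)
  have ms: "csum \<rho> (m t) = (Q * csum \<rho> p) * t\<^sup>2
      + (2 * \<alpha> * csum \<rho> w - 2 * A0 * csum \<rho> p) * t + csum \<rho> e" for t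
    by (simp add: m_def csum_simps) (simp add: algebra_simps)
  have el: "e \<in> lattice \<rho>" "bvec j \<in> lattice \<rho>"
    using bvec_E1 i(1) j(1) assms(1) by (auto simp: e_def E1_def)
  then have "\<alpha> \<in> \<int>" "\<beta> \<in> \<int>"
    using assms(2) lattice_lform by (auto simp: e_def \<alpha>_def \<beta>_def)
  then have wl: "w \<in> lattice \<rho>"
    using el by (auto simp: w_def lattice_def coord_space_def)
  have "A0 \<in> \<int>" using lattice_lform el(1) wl by (simp add: A0_def)
  have ml: "m (real t) \<in> lattice \<rho>" for t :: nat
    using el wl assms(2) \<open>\<alpha> \<in> \<int>\<close> \<open>\<beta> \<in> \<int>\<close> \<open>A0 \<in> \<int>\<close>
    by (auto simp: m_def Q_def lattice_def coord_space_def)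
  define B where "B = (\<bar>2 * \<alpha> * lform \<rho> w n - 2 * A0 * lform \<rho> p n\<bar> + \<bar>lform \<rho> e n\<bar>) / (Q * lform \<rho> p n)
     + (\<bar>2 * \<alpha> * csum \<rho> w - 2 * A0 * csum \<rho> p\<bar> + \<bar>csum \<rho> e\<bar>) / (Q * csum \<rho> p) + 1"
  obtain t :: nat where "real t > B" using reals_Archimedean2 by blast
  have pos: "Q * lform \<rho> p n > 0" "Q * csum \<rho> p > 0" using \<open>Q > 0\<close> assms by simp_all
  have nonneg: "(\<bar>2 * \<alpha> * lform \<rho> w n - 2 * A0 * lform \<rho> p n\<bar> + \<bar>lform \<rho> e n\<bar>) / (Q * lform \<rho> p n) \<ge> 0"
    "(\<bar>2 * \<alpha> * csum \<rho> w - 2 * A0 * csum \<rho> p\<bar> + \<bar>csum \<rho> e\<bar>) / (Q * csum \<rho> p) \<ge> 0"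
    using pos by (simp_all add: divide_nonneg_pos)
  have t: "real t \<ge> 1"
    "(\<bar>2 * \<alpha> * lform \<rho> w n - 2 * A0 * lform \<rho> p n\<bar> + \<bar>lform \<rho> e n\<bar>) / (Q * lform \<rho> p n) < real t"
    "(\<bar>2 * \<alpha> * csum \<rho> w - 2 * A0 * csum \<rho> p\<bar> + \<bar>csum \<rho> e\<bar>) / (Q * csum \<rho> p) < real t"
    using nonneg \<open>real t > B\<close> unfolding B_def by linarith+
  have "lform \<rho> (m t) n > 0"
    unfolding mn using t pos by (intro quadratic_pos) (simp_all add: pos_divide_less_eq mult.commute)
  moreover have "csum \<rho> (m t) > 0"
    unfolding ms using t pos by (intro quadratic_pos) (simp_all add: pos_divide_less_eq mult.commute)
  ultimately show ?thesis
    using that[of "m (real t)"] ml mm mp \<open>\<alpha> < 0\<close> assms(1) by (simp add: E1_iff)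
qed

text \<open>Since m . p < 0 \<le> m . n, the reflection of p in m lies on the positive side of m,
  and its pairing with n is at least p . n > 0. This null ray also lies in the side of an outermost
  k containing that of m.\<close>

lemma open_sides_fill:
  assumes "\<rho> \<ge> 3" "n \<in> coord_space \<rho>" "lform \<rho> n n > 0"
  shows "\<exists>m\<in>E1_star \<rho>. open_side \<rho> n \<inter> open_side \<rho> m \<noteq> {}"
proof -
  obtain p where p: "p \<in> lattice \<rho>" "lform \<rho> p p = 0" "csum \<rho> p > 0" "lform \<rho> p n > 0"
    using exists_lattice_null assms by blast
  obtain m where m: "m \<in> E1 \<rho>" "lform \<rho> m p < 0" "lform \<rho> m n \<ge> 0"
    using exists_E1_near_null assms(1) p by blast
  have mE: "m \<in> coord_space \<rho>" "lform \<rho> m m = 1" "csum \<rho> m > 0"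
    using m(1) assms(1) by (auto simp: E1_iff lattice_coord_space)
  define y where "y = (\<lambda>i. p i - (2 * lform \<rho> m p) * m i)"
  have y: "y \<in> coord_space \<rho>" "lform \<rho> y y = 0" "lform \<rho> m y > 0"
    using p m mE by (simp_all add: y_def coord_space_simps lattice_coord_space lform_simps
        lform_commute[of \<rho> p m])
  have "csum \<rho> y = csum \<rho> p - 2 * (lform \<rho> m p * csum \<rho> m)"
    by (simp add: y_def csum_simps)
  moreover have "lform \<rho> m p * csum \<rho> m < 0" using m mE by (simp add: mult_neg_pos)
  ultimately have ys: "csum \<rho> y > 0" using p by linarith
  have "lform \<rho> n y = lform \<rho> p n - 2 * (lform \<rho> m p * lform \<rho> m n)"
    by (simp add: y_def lform_simps lform_commute[of \<rho> n])
  moreover have "lform \<rho> m p * lform \<rho> m n \<le> 0" using m by (simp add: mult_nonpos_nonneg)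
  ultimately have yn: "lform \<rho> n y > 0" using p by linarith
  have "y \<noteq> 0" using ys by (auto simp: csum_def)
  then have yl: "y \<in> light_cone \<rho>" using y ys assms(1) by (simp add: light_cone_iff causal_def)
  then have yc: "causal \<rho> y" using assms(1) by (simp add: light_cone_iff)
  obtain k where k: "k \<in> E1_star \<rho>" "causal \<rho> (m - k)"
    using E1_star_above assms(1) m(1) by blast
  then have "lform \<rho> (m - k) y \<le> 0" using yc causal_lform_le by blast
  then have yk: "lform \<rho> k y > 0" using y(3) by (simp add: lform_simps)
  define X where "X = ray_rel \<rho> `` {y}"
  have "X \<in> bdry \<rho>" unfolding bdry_def X_def using yl by (rule quotientI)
  moreover have "X \<noteq> ray_rel \<rho> `` {Evec \<rho>}"
  proof
    assume "X = ray_rel \<rho> `` {Evec \<rho>}"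
    moreover have "y \<in> X" unfolding X_def using equiv_ray_rel yl by (rule equiv_class_self)
    ultimately obtain t where "t > 0" "y = (\<lambda>i. t * Evec \<rho> i)" by (auto simp: ray_rel_def)
    then have "lform \<rho> k y = t * lform \<rho> k (Evec \<rho>)" by (simp add: lform_simps)
    moreover have "lform \<rho> k (Evec \<rho>) \<le> 0"
      using E1_lform_Evec_le assms(1) k(1) E1_star_E1 by blast
    ultimately show False using yk \<open>t > 0\<close> by (simp add: zero_less_mult_iff)
  qed
  ultimately have "X \<in> bdryE \<rho>" by (simp add: bdryE_def)
  moreover have "lform \<rho> a x > 0" if "lform \<rho> a y > 0" "x \<in> X" for a x
    using that by (auto simp: X_def ray_rel_def lform_simps)
  ultimately have "X \<in> open_side \<rho> n \<inter> open_side \<rho> k"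
    using yn yk by (auto simp: open_side_def)
  with k show ?thesis by blast
qed

section \<open>Symmetries of the polyhedron and descent\<close>

definition inner_point :: "nat \<Rightarrow> (nat \<Rightarrow> real) \<Rightarrow> bool" where
  "inner_point \<rho> q \<longleftrightarrow> q \<in> coord_space \<rho> \<and> timelike \<rho> q \<and> (\<forall>m\<in>E1 \<rho>. lform \<rho> m q < 0)"

text \<open>Restricted to involutions, so that each map is its own inverse and its own adjoint. The
  fixed inner point settles the signs: an isometry might otherwise exchange the two halves of the
  light cone.\<close>

definition K_symmetry :: "nat \<Rightarrow> ((nat \<Rightarrow> real) \<Rightarrow> nat \<Rightarrow> real) \<Rightarrow> bool" where
  "K_symmetry \<rho> g \<longleftrightarrow>
     (\<forall>x\<in>coord_space \<rho>. g x \<in> coord_space \<rho> \<and> g (g x) = x) \<and>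
     (\<forall>x\<in>coord_space \<rho>. \<forall>y\<in>coord_space \<rho>. lform \<rho> (g x) (g y) = lform \<rho> x y) \<and>
     (\<forall>x\<in>lattice \<rho>. g x \<in> lattice \<rho>) \<and>
     (\<exists>q. inner_point \<rho> q \<and> g q = q)"

lemma E1_csum_1:
  assumes "\<rho> \<ge> 3" "m \<in> E1 \<rho>" "csum \<rho> m = 1"
  shows "\<exists>i\<in>{1..\<rho>}. m = bvec i"
proof -
  obtain i where i: "i \<in> {1..\<rho>}" "m i > 0"
    using assms(3) sum_nonpos[of "{1..\<rho>}" m] unfolding csum_def by (smt (verit))
  moreover have "m i \<in> \<int>" using assms(2) by (simp add: E1_def lattice_def)
  ultimately have "m i \<ge> 1" by (auto elim!: Ints_cases)
  then have "lform \<rho> (bvec i) m \<ge> 1" using i(1) assms(3) by (simp add: lform_bvec_left)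
  moreover have "outermost \<rho> (bvec i)"
    using bvec_E1_star E1_star_iff_outermost i(1) assms(1) by blast
  ultimately have "m = bvec i"
    using assms(2,3) csum_bvec[OF i(1)] by (fastforce simp: outermost_def)
  with i(1) show ?thesis by blast
qed

text \<open>With S, N, c as defined below, 2 sqsum m = 1 + S, and Cauchy-Schwarz gives S (c - N)
  \<le> N. The condition on q says N < s^2 (c - N).\<close>

lemma E1_csum_less:
  assumes "\<rho> \<ge> 3" "m \<in> E1 \<rho>" "q \<in> coord_space \<rho>" "csum \<rho> q > 0"
    "2 * (1 + s\<^sup>2) * sqsum \<rho> q < s\<^sup>2 * (csum \<rho> q)\<^sup>2" "s > 0" "lform \<rho> m q \<ge> 0"
  shows "csum \<rho> m < s"
proof (rule ccontr)
  assume "\<not> ?thesis"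
  then have "s\<^sup>2 \<le> (csum \<rho> m)\<^sup>2" using assms(6) by (simp add: power_mono)
  define S N c where "S = (csum \<rho> m)\<^sup>2" and "N = 2 * sqsum \<rho> q" and "c = (csum \<rho> q)\<^sup>2"
  have m: "lform \<rho> m m = 1" "csum \<rho> m > 0" using assms(1,2) by (auto simp: E1_iff)
  have "S * c \<le> (lform \<rho> m q + csum \<rho> m * csum \<rho> q)\<^sup>2"
    unfolding S_def c_def power_mult_distrib[symmetric]
    using assms(4,7) m by (intro power_mono) auto
  also have "\<dots> \<le> (1 + S) * N"
  proof -
    have "2 * sqsum \<rho> m = 1 + S" using m(1) by (simp add: lform_self S_def)
    then show ?thesis using lform_cauchy[of \<rho> m q] unfolding N_def by simp
  qed
  finally have 1: "S * c \<le> (1 + S) * N" .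
  have 2: "(1 + s\<^sup>2) * N < s\<^sup>2 * c" using assms(5) by (simp add: N_def c_def algebra_simps)
  have 3: "s\<^sup>2 \<le> S" "s\<^sup>2 > 0" "N \<ge> 0"
    using \<open>s\<^sup>2 \<le> _\<close> assms(6) sqsum_nonneg by (auto simp: S_def N_def)
  have "s\<^sup>2 * (c - N) > N" using 2 by (simp add: algebra_simps)
  then have "c - N > 0" using 3 by (smt (verit) mult_nonneg_nonpos)
  then have "s\<^sup>2 * (c - N) \<le> S * (c - N)" using 3 by (intro mult_right_mono) auto
  with 1 \<open>s\<^sup>2 * (c - N) > N\<close> show False by (simp add: algebra_simps)
qed

text \<open>
  The quadratic condition bounds the distance from \<open>q\<close> to \<open>D\<close>: by Cauchy-Schwarz only those \<open>m \<in> \<E>\<^sub>1\<close> with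
  coordinate sum below 3 can have \<open>q\<close> on their positive side, and these are the basis vectors.
\<close>

lemma inner_pointI:
  assumes "\<rho> \<ge> 3" "q \<in> coord_space \<rho>" "csum \<rho> q > 0"
    "20 * sqsum \<rho> q < 9 * (csum \<rho> q)\<^sup>2" "\<And>i. i \<in> {1..\<rho>} \<Longrightarrow> 2 * q i < csum \<rho> q"
  shows "inner_point \<rho> q"
  unfolding inner_point_def
proof (intro conjI ballI)
  show "timelike \<rho> q"
    using assms(3,4) sqsum_nonneg[of \<rho> q] by (simp add: timelike_def lform_self)
  fix m assume m: "m \<in> E1 \<rho>"
  show "lform \<rho> m q < 0"
  proof (rule ccontr)
    assume "\<not> ?thesis"
    \<comment> \<open>For s = 3 the condition of \<open>E1_csum_less\<close> is 20 sqsum q < 9 (csum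
      q)^2; parity then leaves only the sum 1.\<close>
    then have "csum \<rho> m < 3"
      using assms m by (intro E1_csum_less[where q = q]) auto
    moreover obtain k :: int where "odd k" "csum \<rho> m = of_int k"
      using lform_odd(1)[of m \<rho> m] m assms(1) by (auto simp: E1_iff)
    moreover have "csum \<rho> m \<ge> 1" using E1_csum_ge_1 m assms(1) by blast
    ultimately have "k < 3" "1 \<le> k" "odd k" "csum \<rho> m = of_int k" by simp_all
    then have "k = 1" by presburger
    then have "csum \<rho> m = 1" using \<open>csum \<rho> m = of_int k\<close> by simp
    then obtain i where "i \<in> {1..\<rho>}" "m = bvec i"
      using E1_csum_1[OF assms(1) m] by blast
    then show False using \<open>\<not> lform \<rho> m q < 0\<close> assms(5)[of i] by (simp add: lform_bvec_left)
  qed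
qed fact

text \<open>The image has norm 1 and odd, hence nonzero, coordinate sum, so it or its negative is in
  E1. Its pairing with the fixed inner point equals that of n and is negative, which excludes the
  second case.\<close>

lemma K_symmetry_E1:
  assumes "\<rho> \<ge> 3" "K_symmetry \<rho> g" "n \<in> E1 \<rho>"
  shows "g n \<in> E1 \<rho>"
proof -
  obtain q where q: "inner_point \<rho> q" "g q = q" using assms(2) by (auto simp: K_symmetry_def)
  have n: "n \<in> lattice \<rho>" "n \<in> coord_space \<rho>" "lform \<rho> n n = 1" "lform \<rho> n q < 0"
    using assms q by (auto simp: E1_iff inner_point_def lattice_coord_space)
  have gn: "g n \<in> lattice \<rho>" "lform \<rho> (g n) (g n) = 1"
    using assms(2) n by (auto simp: K_symmetry_def)
  have gq: "lform \<rho> (g n) q < 0"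
    using assms(2) n q unfolding K_symmetry_def inner_point_def by metis
  have "csum \<rho> (g n) \<noteq> 0"
    using lform_odd(1)[OF gn(1,1) gn(2,2)] by auto
  moreover have "\<not> csum \<rho> (g n) < 0"
  proof
    assume "csum \<rho> (g n) < 0"
    then have "- g n \<in> E1 \<rho>"
      using gn assms(1) by (auto simp: E1_iff lattice_def coord_space_def lform_simps csum_simps)
    then have "lform \<rho> (- g n) q < 0" using q(1) unfolding inner_point_def by blast
    with gq show False by (simp add: lform_simps)
  qed
  ultimately show ?thesis using gn assms(1) by (simp add: E1_iff)
qed

lemma K_symmetry_hyp:
  assumes "\<rho> \<ge> 3" "K_symmetry \<rho> g" "x \<in> hyp \<rho>"
  shows "g x \<in> hyp \<rho>"
proof -
  obtain q where q: "inner_point \<rho> q" "g q = q" using assms(2) by (auto simp: K_symmetry_def)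
  then have qt: "timelike \<rho> q" "q \<in> coord_space \<rho>" by (auto simp: inner_point_def)
  have x: "x \<in> coord_space \<rho>" "lform \<rho> x x = -1" "timelike \<rho> x"
    using assms by (auto simp: hyp_iff)
  then have "lform \<rho> x q \<le> 0" using causal_lform_le qt timelike_causal by blast
  then have "lform \<rho> (g x) q \<le> 0" "lform \<rho> (g x) (g x) = -1" "g x \<in> coord_space \<rho>"
    using assms(2) x q(2) qt unfolding K_symmetry_def by metis+
  then show ?thesis using timelikeI_timelike[OF qt(1)] assms(1) by (simp add: hyp_iff)
qed

lemma K_symmetry_E1_star:
  assumes "\<rho> \<ge> 3" "K_symmetry \<rho> g" "n \<in> E1_star \<rho>"
  shows "g n \<in> E1_star \<rho>"
proof -
  obtain x where x: "x \<in> hyp \<rho>" "lform \<rho> n x = 0" "\<forall>m\<in>E1 \<rho>. lform \<rho> m x \<le> 0"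
    and n: "n \<in> E1 \<rho>"
    using assms by (auto simp: E1_star_iff)
  have xc: "x \<in> coord_space \<rho>" "n \<in> coord_space \<rho>"
    using x n by (auto simp: hyp_def E1_coord_space)
  have "lform \<rho> m (g x) \<le> 0" if m: "m \<in> E1 \<rho>" for m
  proof -
    have "m \<in> coord_space \<rho>" using m E1_coord_space by blast
    then have "lform \<rho> m (g x) = lform \<rho> (g m) x"
      using assms(2) xc unfolding K_symmetry_def by metis
    then show ?thesis using x(3) K_symmetry_E1[OF assms(1,2) m] by simp
  qed
  moreover have "lform \<rho> (g n) (g x) = 0"
    using assms(2) xc x(2) unfolding K_symmetry_def by metis
  ultimately show ?thesis
    using K_symmetry_E1[OF assms(1,2) n] K_symmetry_hyp[OF assms(1,2) x(1)] assms(1)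
    by (auto simp: E1_star_iff)
qed

text \<open>The source of integrality for reflections in vectors of norm 4 and for the maps phi:
  their coefficients are halves of pairings.\<close>

lemma lform_half_int:
  assumes "v \<in> lattice \<rho>" "csum \<rho> v / 2 \<in> \<int>" "x \<in> lattice \<rho>"
  shows "lform \<rho> v x / 2 \<in> \<int>"
proof -
  have "lform \<rho> v x / 2 = (\<Sum>i=1..\<rho>. v i * x i) - csum \<rho> v / 2 * csum \<rho> x"
    by (simp add: lform_def csum_def)
  also have "\<dots> \<in> \<int>"
    using assms lattice_csum by (intro Ints_diff Ints_mult Ints_sum) (auto simp: lattice_def)
  finally show ?thesis .
qed

lemma K_symmetry_reflection:
  assumes "v \<in> lattice \<rho>" "lform \<rho> v v = 4" "csum \<rho> v / 2 \<in> \<int>"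
    "inner_point \<rho> q" "lform \<rho> v q = 0"
  shows "K_symmetry \<rho> (reflection \<rho> v)"
proof -
  have r: "reflection \<rho> v x = (\<lambda>i. x i - (lform \<rho> v x / 2) * v i)" for x
    by (simp add: reflection_def assms(2))
  have v: "v \<in> coord_space \<rho>" using assms(1) lattice_coord_space by blast
  show ?thesis
    unfolding K_symmetry_def
  proof (intro conjI ballI)
    fix x y assume x: "x \<in> coord_space \<rho>"
    show "reflection \<rho> v x \<in> coord_space \<rho>"
      unfolding r using v x by (intro coord_space_simps)
    show "reflection \<rho> v (reflection \<rho> v x) = x"
      by (simp add: r lform_simps assms(2))
    show "lform \<rho> (reflection \<rho> v x) (reflection \<rho> v y) = lform \<rho> x y"
      by (simp add: r lform_simps assms(2) lform_commute[of \<rho> x v])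
  next
    fix x assume x: "x \<in> lattice \<rho>"
    define c where "c = lform \<rho> v x / 2"
    have "c \<in> \<int>" unfolding c_def using lform_half_int[OF assms(1,3) x] .
    moreover have "reflection \<rho> v x = (\<lambda>i. x i - c * v i)" by (simp add: r c_def)
    ultimately show "reflection \<rho> v x \<in> lattice \<rho>"
      using assms(1) x by (auto simp: lattice_def coord_space_def)
  next
    show "\<exists>q. inner_point \<rho> q \<and> reflection \<rho> v q = q"
      using assms(4,5) by (auto simp: r)
  qed
qed

text \<open>The map is the identity on the plane of P and Q, so a fixed inner point is sought in
  that plane.\<close>

lemma K_symmetry_phi:
  assumes "P \<in> coord_space \<rho>" "Q \<in> coord_space \<rho>"
    "lform \<rho> P P = 0" "lform \<rho> Q Q = 0" "lform \<rho> P Q = pq" "pq \<noteq> 0"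
    "\<And>x. x \<in> lattice \<rho> \<Longrightarrow> phi \<rho> P Q x \<in> lattice \<rho>"
    "inner_point \<rho> (\<lambda>i. a * P i + b * Q i)"
  shows "K_symmetry \<rho> (phi \<rho> P Q)"
proof -
  have r: "phi \<rho> P Q x = (\<lambda>i. (2 * lform \<rho> P x / pq) * Q i + (2 * lform \<rho> Q x / pq) * P i - x i)" for x
    by (simp add: phi_def assms(5) add_divide_distrib distrib_left mult.assoc)
  have QP: "lform \<rho> Q P = pq" using assms(5) by (simp add: lform_commute)
  show ?thesis
    unfolding K_symmetry_def
  proof (intro conjI ballI)
    fix x y assume x: "x \<in> coord_space \<rho>"
    show "phi \<rho> P Q x \<in> coord_space \<rho>"
      unfolding r using assms(1,2) x by (intro coord_space_simps)
    show "phi \<rho> P Q (phi \<rho> P Q x) = x"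
      using assms(6) by (simp add: r lform_simps assms(3-5) QP)
    show "lform \<rho> (phi \<rho> P Q x) (phi \<rho> P Q y) = lform \<rho> x y"
      using assms(6) by (simp add: r lform_simps assms(3-5) QP lform_commute[of \<rho> x P]
          lform_commute[of \<rho> x Q] field_simps)
  next
    fix x assume "x \<in> lattice \<rho>"
    then show "phi \<rho> P Q x \<in> lattice \<rho>" by (rule assms(7))
  next
    show "\<exists>q. inner_point \<rho> q \<and> phi \<rho> P Q q = q"
      using assms(6) by (intro exI[of _ "\<lambda>i. a * P i + b * Q i"] conjI assms(8))
        (simp add: r lform_simps assms(3-5) QP)
  qed
qed

lemma phi_lattice_4:
  assumes "P \<in> lattice \<rho>" "csum \<rho> P / 2 \<in> \<int>" "Q \<in> lattice \<rho>" "csum \<rho> Q / 2 \<in> \<int>"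
    "lform \<rho> P Q = -4" "x \<in> lattice \<rho>"
  shows "phi \<rho> P Q x \<in> lattice \<rho>"
proof -
  define c d where "c = lform \<rho> P x / 2" and "d = lform \<rho> Q x / 2"
  have "phi \<rho> P Q x = (\<lambda>i. - c * Q i - d * P i - x i)"
    by (simp add: phi_def assms(5) c_def d_def fun_eq_iff field_simps)
  moreover have "c \<in> \<int>" "d \<in> \<int>"
    unfolding c_def d_def using lform_half_int assms by blast+
  ultimately show ?thesis
    using assms by (auto simp: lattice_def coord_space_def)
qed

text \<open>With P . Q = -8 the coefficients are quarters of pairings; substituting Q = P + 2 R
  turns them into halves.\<close>

lemma phi_lattice_8:
  assumes "P \<in> lattice \<rho>" "R \<in> lattice \<rho>" "(csum \<rho> P + csum \<rho> R) / 2 \<in> \<int>"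
    "(csum \<rho> P) / 2 \<in> \<int>" "Q = (\<lambda>i. P i + 2 * R i)"
    "lform \<rho> P Q = -8" "x \<in> lattice \<rho>"
  shows "phi \<rho> P Q x \<in> lattice \<rho>"
proof -
  define c d where "c = lform \<rho> P x / 2" and "d = lform \<rho> (\<lambda>i. P i + R i) x / 2"
  have "phi \<rho> P Q x = (\<lambda>i. - d * P i - c * R i - x i)"
    unfolding phi_def assms(6)
    by (simp add: assms(5) c_def d_def lform_simps fun_eq_iff field_simps)
  moreover have "c \<in> \<int>" "d \<in> \<int>"
    unfolding c_def d_def using assms by (auto intro!: lform_half_int
      simp: csum_simps lattice_def coord_space_def)
  ultimately show ?thesis
    using assms(1,2,7) by (auto simp: lattice_def coord_space_def)
qed

text \<open>
  Since the generators are involutive isometries, the height of the image of \<open>n\<close> under a word in them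
  is the pairing of \<open>n\<close> with the image of \<open>w\<close> under the reversed word.
\<close>

inductive_set reachable :: "((nat \<Rightarrow> real) \<Rightarrow> nat \<Rightarrow> real) set \<Rightarrow> (nat \<Rightarrow> real) \<Rightarrow> (nat \<Rightarrow> real) set"
  for G w where
  reach_refl: "w \<in> reachable G w"
| reach_step: "x \<in> reachable G w \<Longrightarrow> g \<in> G \<Longrightarrow> g x \<in> reachable G w"

text \<open>Here n' is the image of n under the reversed word. Membership in the invariant set A,
  later an orbit, pulls back from n' to n because the generators are involutions.\<close>

lemma reachable_transport:
  assumes "\<rho> \<ge> 3" "\<forall>g\<in>G. K_symmetry \<rho> g" "w \<in> coord_space \<rho>" "w' \<in> reachable G w"
    "n \<in> E1_star \<rho>" "\<forall>g\<in>G. \<forall>x\<in>A. g x \<in> A"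
  shows "w' \<in> coord_space \<rho> \<and>
    (\<exists>n'\<in>E1_star \<rho>. lform \<rho> w' n = lform \<rho> w n' \<and> (n' \<in> A \<longrightarrow> n \<in> A))"
  using assms(4,5)
proof (induction arbitrary: n)
  case reach_refl
  then show ?case using assms(3) by blast
next
  case (reach_step x g)
  have g: "K_symmetry \<rho> g" using assms(2) reach_step.hyps by blast
  have x: "x \<in> coord_space \<rho>" using reach_step.IH reach_step.prems by blast
  have n: "n \<in> coord_space \<rho>" using reach_step.prems E1_star_E1 E1_coord_space by blast
  have gn: "g n \<in> E1_star \<rho>" using K_symmetry_E1_star assms(1) g reach_step.prems by blast
  obtain n' where n': "n' \<in> E1_star \<rho>" "lform \<rho> x (g n) = lform \<rho> w n'" "n' \<in> A \<longrightarrow> g n \<in> A"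
    using reach_step.IH[OF gn] by blast
  have "lform \<rho> (g x) n = lform \<rho> x (g n)" "g (g n) = n" "g x \<in> coord_space \<rho>"
    using g x n unfolding K_symmetry_def by metis+
  moreover have "n' \<in> A \<longrightarrow> n \<in> A"
    using n'(3) assms(6) reach_step.hyps(2) \<open>g (g n) = n\<close> by metis
  ultimately show ?case using n'(1,2) by metis
qed

text \<open>Since w is integral and inside K, its pairings with E1* are negative integers and can be
  increased only finitely often within an orbit.\<close>

lemma E1_star_descent:
  assumes "\<rho> \<ge> 3" "\<forall>g\<in>G. K_symmetry \<rho> g" "inner_point \<rho> w" "w \<in> lattice \<rho>"
    "\<forall>g\<in>G. \<forall>x\<in>A. g x \<in> A" "a \<in> A"
    "\<And>n. n \<in> E1_star \<rho> \<Longrightarrow> (\<And>w'. w' \<in> reachable G w \<Longrightarrow> lform \<rho> w' n \<le> lform \<rho> w n) \<Longrightarrow> n = a"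
    "n \<in> E1_star \<rho>"
  shows "n \<in> A"
  using assms(8)
proof (induction "nat \<lfloor>- lform \<rho> w n\<rfloor>" arbitrary: n rule: less_induct)
  case less
  show ?case
  proof (cases "\<forall>w'\<in>reachable G w. lform \<rho> w' n \<le> lform \<rho> w n")
    case True
    then show ?thesis using assms(6,7) less.prems by blast
  next
    case False
    then obtain w' where w': "w' \<in> reachable G w" "lform \<rho> w' n > lform \<rho> w n" by force
    then obtain n' where n': "n' \<in> E1_star \<rho>" "lform \<rho> w' n = lform \<rho> w n'" "n' \<in> A \<longrightarrow> n \<in> A"
      using reachable_transport[OF assms(1,2)
          lattice_coord_space[OF assms(4)] w'(1) less.prems assms(5)]
      by blast
    have *: "lform \<rho> w n' < 0" "lform \<rho> w n' \<in> \<int>" "lform \<rho> w n \<in> \<int>"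
      using assms(3,4) n'(1) less.prems E1_star_E1 lattice_lform
      by (auto simp: inner_point_def lform_commute[of \<rho> w] E1_def)
    have "lform \<rho> w n' > lform \<rho> w n" using n' w' by simp
    with * have "nat \<lfloor>- lform \<rho> w n'\<rfloor> < nat \<lfloor>- lform \<rho> w n\<rfloor>"
      by (auto elim!: Ints_cases)
    then show ?thesis using less.hyps n' by blast
  qed
qed

section \<open>The generated group and the reduction to minimal vectors\<close>

definition Gamma_gens :: "nat \<Rightarrow> ((nat \<Rightarrow> real) \<Rightarrow> nat \<Rightarrow> real) set" where
  "Gamma_gens \<rho> = gens_common \<rho> \<union> gens_extra \<rho>"

text \<open>That a generator is its own inverse disposes of the inverse case of
  \<open>generate\<close>.\<close>

lemma K_symmetry_BijGroup:
  assumes "K_symmetry \<rho> g"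
  shows "restrict g (coord_space \<rho>) \<in> carrier (BijGroup (coord_space \<rho>))"
    "m_inv (BijGroup (coord_space \<rho>)) (restrict g (coord_space \<rho>)) = restrict g (coord_space \<rho>)"
proof -
  let ?V = "coord_space \<rho>" and ?g = "restrict g (coord_space \<rho>)"
  have g: "\<And>x. x \<in> ?V \<Longrightarrow> g x \<in> ?V" "\<And>x. x \<in> ?V \<Longrightarrow> g (g x) = x"
    using assms by (auto simp: K_symmetry_def)
  then have "bij_betw ?g ?V ?V"
    by (intro bij_betw_byWitness[where f' = ?g]) auto
  then have b: "?g \<in> Bij ?V" by (simp add: Bij_def)
  then show "?g \<in> carrier (BijGroup ?V)" by (simp add: BijGroup_def)
  moreover have "compose ?V ?g ?g = (\<lambda>x\<in>?V. x)"
    using g by (auto simp: compose_def fun_eq_iff)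
  ultimately show "m_inv (BijGroup ?V) ?g = ?g"
    using b by (intro group.inv_equality group_BijGroup) (auto simp: BijGroup_def)
qed

lemma Gamma_action:
  assumes "\<rho> \<ge> 3" "\<forall>g\<in>Gamma_gens \<rho>. K_symmetry \<rho> g" "\<gamma> \<in> Gamma \<rho>"
  shows "\<gamma> \<in> Bij (coord_space \<rho>) \<and>
    (\<forall>x\<in>coord_space \<rho>. \<forall>y\<in>coord_space \<rho>. lform \<rho> (\<gamma> x) (\<gamma> y) = lform \<rho> x y) \<and>
    (\<forall>n\<in>E1_star \<rho>. \<gamma> n \<in> E1_star \<rho>)"
proof -
  let ?V = "coord_space \<rho>"
  have EV: "E1_star \<rho> \<subseteq> ?V" using E1_star_E1 E1_coord_space by blast
  have gen: "restrict g ?V \<in> Bij ?V \<and>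
    (\<forall>x\<in>?V. \<forall>y\<in>?V. lform \<rho> (restrict g ?V x) (restrict g ?V y) = lform \<rho> x y) \<and>
    (\<forall>n\<in>E1_star \<rho>. restrict g ?V n \<in> E1_star \<rho>)" if "g \<in> Gamma_gens \<rho>" for g
    using assms(2) that K_symmetry_BijGroup[of \<rho> g] K_symmetry_E1_star[OF assms(1)] EV
    by (auto simp: BijGroup_def K_symmetry_def)
  show ?thesis
    using assms(3) unfolding Gamma_def
  proof (induction rule: generate.induct)
    case one
    have "\<one>\<^bsub>BijGroup ?V\<^esub> = (\<lambda>x\<in>?V. x)" by (simp add: BijGroup_def)
    then show ?case using EV id_Bij[of ?V] by (auto simp del: restrict_apply simp: restrict_apply')
  next
    case (incl h)
    then show ?case using gen by (auto simp: Gamma_gens_def)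
  next
    case (inv h)
    then obtain g where g: "g \<in> Gamma_gens \<rho>" "h = restrict g ?V"
      by (auto simp: Gamma_gens_def)
    then have inv_h: "m_inv (BijGroup ?V) h = h"
      using K_symmetry_BijGroup(2) assms(2) by blast
    show ?case unfolding inv_h unfolding g(2) by (rule gen[OF g(1)])
  next
    case (eng h1 h2)
    then have mult: "h1 \<otimes>\<^bsub>BijGroup ?V\<^esub> h2 = compose ?V h1 h2" and b: "compose ?V h1 h2 \<in> Bij ?V"
      by (simp_all add: BijGroup_def compose_Bij)
    have "\<And>x. x \<in> ?V \<Longrightarrow> h2 x \<in> ?V"
      using eng.IH(2) by (auto simp: Bij_def bij_betw_def)
    then show ?case
      unfolding mult using eng.IH EV by (intro conjI b) (auto simp: compose_def)
  qed
qed

lemma Gamma_orbit_step: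
  assumes "\<forall>g\<in>Gamma_gens \<rho>. K_symmetry \<rho> g" "\<rho> \<ge> 3" "a \<in> coord_space \<rho>"
    "g \<in> Gamma_gens \<rho>" "x \<in> (\<lambda>\<gamma>. \<gamma> a) ` Gamma \<rho>"
  shows "g x \<in> (\<lambda>\<gamma>. \<gamma> a) ` Gamma \<rho>"
proof -
  let ?V = "coord_space \<rho>"
  obtain \<gamma> where \<gamma>: "\<gamma> \<in> Gamma \<rho>" "x = \<gamma> a" using assms(5) by blast
  have "restrict g ?V \<in> Gamma \<rho>"
    unfolding Gamma_def using assms(4) by (intro generate.incl) (auto simp: Gamma_gens_def)
  then have "restrict g ?V \<otimes>\<^bsub>BijGroup ?V\<^esub> \<gamma> \<in> Gamma \<rho>"
    using \<gamma>(1) unfolding Gamma_def by (rule generate.eng)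
  moreover have "(restrict g ?V \<otimes>\<^bsub>BijGroup ?V\<^esub> \<gamma>) a = g x"
  proof -
    have "\<gamma> \<in> Bij ?V" using Gamma_action assms(1,2) \<gamma>(1) by blast
    moreover have "restrict g ?V \<in> Bij ?V"
      using K_symmetry_BijGroup(1)[of \<rho> g] assms(1,4) by (simp add: BijGroup_def)
    moreover have "\<gamma> a \<in> ?V" using \<open>\<gamma> \<in> Bij ?V\<close> assms(3) by (auto simp: Bij_def bij_betw_def)
    ultimately show ?thesis using assms(3) \<gamma>(2) by (simp add: BijGroup_def compose_def)
  qed
  ultimately show ?thesis by (metis image_eqI)
qed

definition packing_property :: "nat \<Rightarrow> bool" where
  "packing_property \<rho> \<longleftrightarrow>
    K' \<rho> = K \<rho>
    \<and> (\<forall>n\<in>E1_star \<rho>. \<forall>m\<in>E1_star \<rho>. n \<noteq> m \<longrightarrow> open_side \<rho> n \<inter> open_side \<rho> m = {})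
    \<and> \<not> (\<exists>n\<in>coord_space \<rho>. lform \<rho> n n > 0 \<and>
           (\<forall>m\<in>E1_star \<rho>. open_side \<rho> n \<inter> open_side \<rho> m = {}))
    \<and> (\<forall>n\<in>E1_star \<rho>. \<exists>C\<subseteq>E1_star \<rho>. card C = \<rho> \<and> n \<in> C \<and>
           (\<forall>a\<in>C. \<forall>b\<in>C. a \<noteq> b \<longrightarrow> lform \<rho> a b = - 1))"

text \<open>What depends on rho is confined to the hypotheses. By \<open>min\<close> the descent can
  stop only at e_rho, so the orbit of e_rho is all of E1*.\<close>

lemma packing_of_orbit:
  assumes \<rho>: "\<rho> \<ge> 3"
    and gens: "\<forall>g\<in>Gamma_gens \<rho>. K_symmetry \<rho> g"
    and w: "inner_point \<rho> w" "w \<in> lattice \<rho>"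
    and min: "\<And>n. n \<in> E1_star \<rho> \<Longrightarrow>
      (\<And>w'. w' \<in> reachable (Gamma_gens \<rho>) w \<Longrightarrow> lform \<rho> w' n \<le> lform \<rho> w n) \<Longrightarrow> n = bvec \<rho>"
  shows "packing_property \<rho>"
  unfolding packing_property_def
proof (intro conjI)
  let ?V = "coord_space \<rho>"
  have b\<rho>: "bvec \<rho> \<in> E1_star \<rho>" "bvec \<rho> \<in> ?V" using bvec_E1_star bvec_in \<rho> by auto
  have "(\<lambda>x\<in>?V. x) \<in> Gamma \<rho>"
    unfolding Gamma_def using generate.one[of "BijGroup ?V"] by (simp add: BijGroup_def)
  then have "bvec \<rho> \<in> (\<lambda>\<gamma>. \<gamma> (bvec \<rho>)) ` Gamma \<rho>"
    using b\<rho>(2) by (intro image_eqI[where x = "\<lambda>x\<in>?V. x"]) auto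
  then have "n \<in> (\<lambda>\<gamma>. \<gamma> (bvec \<rho>)) ` Gamma \<rho>" if "n \<in> E1_star \<rho>" for n
    using E1_star_descent[OF \<rho> gens w _ _ _ that, of "(\<lambda>\<gamma>. \<gamma> (bvec \<rho>)) ` Gamma \<rho>" "bvec \<rho>"]
      Gamma_orbit_step[OF gens \<rho> b\<rho>(2)] min by blast
  then have orbit: "(\<lambda>\<gamma>. \<gamma> (bvec \<rho>)) ` Gamma \<rho> = E1_star \<rho>"
    using Gamma_action[OF \<rho> gens] b\<rho>(1) by blast
  have "K' \<rho> = (\<Inter>n\<in>(\<lambda>\<gamma>. \<gamma> (bvec \<rho>)) ` Gamma \<rho>. Hminus \<rho> n)"
    by (simp add: K'_def)
  then show "K' \<rho> = K \<rho>" using orbit K_eq_Inter_E1_star[OF \<rho>] by simp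
  show "\<forall>n\<in>E1_star \<rho>. \<forall>m\<in>E1_star \<rho>. n \<noteq> m \<longrightarrow> open_side \<rho> n \<inter> open_side \<rho> m = {}"
    using open_sides_disjoint[OF \<rho>] by blast
  show "\<not> (\<exists>n\<in>coord_space \<rho>. lform \<rho> n n > 0 \<and>
           (\<forall>m\<in>E1_star \<rho>. open_side \<rho> n \<inter> open_side \<rho> m = {}))"
    using open_sides_fill[OF \<rho>] by blast
  show "\<forall>n\<in>E1_star \<rho>. \<exists>C\<subseteq>E1_star \<rho>. card C = \<rho> \<and> n \<in> C \<and>
           (\<forall>a\<in>C. \<forall>b\<in>C. a \<noteq> b \<longrightarrow> lform \<rho> a b = - 1)"
  proof
    fix n assume "n \<in> E1_star \<rho>"
    then obtain \<gamma> where \<gamma>: "\<gamma> \<in> Gamma \<rho>" "n = \<gamma> (bvec \<rho>)" using orbit by blast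
    define C where "C = (\<lambda>i. \<gamma> (bvec i)) ` {1..\<rho>}"
    have act: "\<gamma> \<in> Bij ?V" "\<And>x y. x \<in> ?V \<Longrightarrow> y \<in> ?V \<Longrightarrow> lform \<rho> (\<gamma> x) (\<gamma> y) = lform \<rho> x y"
      "\<And>n. n \<in> E1_star \<rho> \<Longrightarrow> \<gamma> n \<in> E1_star \<rho>"
      using Gamma_action[OF \<rho> gens \<gamma>(1)] by auto
    have inj: "inj_on \<gamma> ?V" using act(1) by (simp add: Bij_def bij_betw_def)
    have "inj_on (\<lambda>i. \<gamma> (bvec i)) {1..\<rho>}"
    proof (rule inj_onI)
      fix i j assume ij: "i \<in> {1..\<rho>}" "j \<in> {1..\<rho>}" "\<gamma> (bvec i) = \<gamma> (bvec j)"
      then have "bvec i = bvec j" using inj bvec_in by (meson inj_onD)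
      then have "bvec i i = bvec j i" by simp
      then show "i = j" by (simp add: bvec_def split: if_splits)
    qed
    then have "card C = \<rho>" by (simp add: C_def card_image)
    moreover have "C \<subseteq> E1_star \<rho>" using act(3) bvec_E1_star \<rho> by (auto simp: C_def)
    moreover have "n \<in> C" using \<gamma>(2) \<rho> by (auto simp: C_def)
    moreover have "\<forall>a\<in>C. \<forall>b\<in>C. a \<noteq> b \<longrightarrow> lform \<rho> a b = - 1"
      using act(2) bvec_in lform_bvec by (auto simp: C_def)
    ultimately show "\<exists>C\<subseteq>E1_star \<rho>. card C = \<rho> \<and> n \<in> C \<and>
           (\<forall>a\<in>C. \<forall>b\<in>C. a \<noteq> b \<longrightarrow> lform \<rho> a b = - 1)" by blast
  qed
qed

section \<open>Computations in coordinates\<close>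

lemma bvec_apply: "bvec i k = (if k = i then 1 else 0)"
  by (simp add: bvec_def)

lemma coords_apply: "coords xs k = (if k \<in> {1..length xs} then xs ! (k - 1) else 0)"
  by (simp add: coords_def)

lemma inner_point_Dvec: "\<rho> \<ge> 3 \<Longrightarrow> inner_point \<rho> (Dvec \<rho>)"
  using Dvec_in csum_Dvec[of \<rho>]
  by (intro inner_pointI) (auto simp: Dvec_eq sqsum_def power2_eq_square)

lemma lform_bvec_diff:
  assumes "i \<in> {1..\<rho>}" "j \<in> {1..\<rho>}"
  shows "lform \<rho> (bvec i - bvec j) x = 2 * (x i - x j)"
  using assms by (simp add: lform_simps lform_bvec_left)

lemma K_symmetry_swap:
  assumes "\<rho> \<ge> 3" "i \<in> {1..\<rho>}" "j \<in> {1..\<rho>}" "i \<noteq> j"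
  shows "K_symmetry \<rho> (reflection \<rho> (bvec i - bvec j))"
proof (rule K_symmetry_reflection)
  show "bvec i - bvec j \<in> lattice \<rho>"
    using assms by (auto simp: lattice_def coord_space_def bvec_apply)
  show "csum \<rho> (bvec i - bvec j) / 2 \<in> \<int>" using assms by (simp add: csum_simps csum_bvec)
  show "lform \<rho> (bvec i - bvec j) (bvec i - bvec j) = 4"
    using assms by (simp add: lform_bvec_diff) (simp add: bvec_apply)
  show "inner_point \<rho> (Dvec \<rho>)" using inner_point_Dvec assms(1) .
  show "lform \<rho> (bvec i - bvec j) (Dvec \<rho>) = 0"
    using assms by (simp add: lform_bvec_diff Dvec_eq)
qed

lemma lform_uvec:
  assumes "{i, j, k, l} \<subseteq> {1..\<rho>}"
  shows "lform \<rho> (bvec i - bvec j + bvec k + bvec l) x = 2 * (x i - x j + x k + x l - csum \<rho> x)"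
  using assms by (simp add: lform_simps lform_bvec_left)

lemma csum_uvec:
  assumes "{i, j, k, l} \<subseteq> {1..\<rho>}"
  shows "csum \<rho> (bvec i - bvec j + bvec k + bvec l) = 2" "csum \<rho> (bvec i + bvec k + bvec l) = 3"
proof -
  have "csum \<rho> (bvec i) = 1" "csum \<rho> (bvec j) = 1" "csum \<rho> (bvec k) = 1" "csum \<rho> (bvec l) = 1"
    using assms csum_bvec by auto
  then show "csum \<rho> (bvec i - bvec j + bvec k + bvec l) = 2" "csum \<rho> (bvec i + bvec k + bvec l) = 3"
    by (simp_all only: csum_simps)
qed

lemma lform_uvec_self:
  assumes "{i, j, k, l} \<subseteq> {1..\<rho>}" "distinct [i, j, k, l]"
  shows "lform \<rho> (bvec i - bvec j + bvec k + bvec l) (bvec i - bvec j + bvec k + bvec l) = 4"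
  unfolding lform_uvec[OF assms(1)] csum_uvec[OF assms(1)]
  using assms(2) by (simp add: bvec_apply)

lemma K_symmetry_uvec:
  assumes "\<rho> \<ge> 3" and sub: "{i, j, k, l} \<subseteq> {1..\<rho>}" and dist: "distinct [i, j, k, l]"
  shows "K_symmetry \<rho> (reflection \<rho> (bvec i - bvec j + bvec k + bvec l))"
proof (rule K_symmetry_reflection)
  \<comment> \<open>D is not on this mirror. The sum of three basis vectors is, and it meets
    \<open>inner_pointI\<close> with 60 < 81 and 2 < 3.\<close>
  let ?u = "bvec i - bvec j + bvec k + bvec l" and ?q = "bvec i + bvec k + bvec l"
  have b: "bvec m \<in> coord_space \<rho>" if "m \<in> {i, j, k, l}" for m
    using that sub bvec_in by blast
  then show "?u \<in> lattice \<rho>"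
    unfolding lattice_def by (auto simp: coord_space_simps bvec_def)
  show "csum \<rho> ?u / 2 \<in> \<int>" by (simp add: csum_uvec[OF sub])
  show "lform \<rho> ?u ?u = 4" using lform_uvec_self[OF sub dist] .
  show "lform \<rho> ?u ?q = 0"
    unfolding lform_uvec[OF sub] csum_uvec[OF sub] using dist by (simp add: bvec_apply)
  have "lform \<rho> (bvec m) ?q = -1" if "m \<in> {i, k, l}" for m
    using that sub dist lform_bvec_left[of m \<rho> ?q] csum_uvec(2)[OF sub]
    by (auto simp: bvec_apply)
  then have "lform \<rho> ?q ?q = -3" by (simp add: lform_simps(1))
  then have "sqsum \<rho> ?q = 3" by (simp add: lform_self csum_uvec[OF sub])
  moreover have "?q \<in> coord_space \<rho>" using b by (simp add: coord_space_simps)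
  moreover have "2 * ?q m < 3" for m
    using dist by (simp add: bvec_apply)
  ultimately show "inner_point \<rho> ?q"
    using assms(1) by (intro inner_pointI) (simp_all add: csum_uvec[OF sub])
qed

lemma K_symmetry_gens_common:
  assumes "\<rho> \<ge> 4" "g \<in> gens_common \<rho>"
  shows "K_symmetry \<rho> g"
  using assms unfolding gens_common_def by (auto intro!: K_symmetry_swap K_symmetry_uvec)

section \<open>Vectors and reflections as operations on coordinate lists\<close>

lemma coords_in: "length xs = \<rho> \<Longrightarrow> coords xs \<in> coord_space \<rho>"
  by (auto simp: coords_apply coord_space_def)

lemma coords_eqI:
  assumes "x \<in> coord_space (length xs)" "\<And>k. k < length xs \<Longrightarrow> x (Suc k) = xs ! k"
  shows "x = coords xs"
proof
  fix k
  show "x k = coords xs k"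
    using assms(1) assms(2)[of "k - 1"] by (cases k) (auto simp: coords_apply coord_space_def)
qed

lemma csum_coords: "length xs = \<rho> \<Longrightarrow> csum \<rho> (coords xs) = sum_list xs"
  by (auto simp: csum_def coords_apply sum.atLeast1_atMost_eq sum_list_sum_nth atLeast0LessThan)

lemma sqsum_coords: "length xs = \<rho> \<Longrightarrow> sqsum \<rho> (coords xs) = (\<Sum>x\<leftarrow>xs. x\<^sup>2)"
  by (auto simp: sqsum_def coords_apply sum.atLeast1_atMost_eq sum_list_sum_nth atLeast0LessThan)

lemma lform_coords:
  assumes "length xs = \<rho>" "length ys = \<rho>"
  shows "lform \<rho> (coords xs) (coords ys) = 2 * sum_list (map2 (*) xs ys) - sum_list xs * sum_list ys"
proof -
  have "(\<Sum>i=1..\<rho>. coords xs i * coords ys i) = sum_list (map2 (*) xs ys)"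
    using assms
    by (auto simp: coords_apply sum.atLeast1_atMost_eq sum_list_sum_nth atLeast0LessThan)
  moreover have "lform \<rho> (coords xs) (coords ys) = 2 * (\<Sum>i=1..\<rho>. coords xs i * coords ys i)
      - csum \<rho> (coords xs) * csum \<rho> (coords ys)"
    by (simp add: lform_def csum_def)
  ultimately show ?thesis using csum_coords assms by simp
qed

lemma coords_lattice:
  "length xs = \<rho> \<Longrightarrow> \<forall>x\<in>set xs. x \<in> \<int> \<Longrightarrow> coords xs \<in> lattice \<rho>"
  by (auto simp: lattice_def coords_in coords_apply)

lemma coords_lincomb:
  "length xs = length ys \<Longrightarrow>
    (\<lambda>i. a * coords xs i + b * coords ys i) = coords (map2 (\<lambda>x y. a * x + b * y) xs ys)"
  by (intro coords_eqI) (auto simp: coords_apply coord_space_def)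

lemma inner_point_coords:
  assumes "\<rho> \<ge> 3" "length xs = \<rho>" "sum_list xs > 0" "20 * (\<Sum>x\<leftarrow>xs. x\<^sup>2) < 9 * (sum_list xs)\<^sup>2"
    "\<forall>x\<in>set xs. 2 * x < sum_list xs"
  shows "inner_point \<rho> (coords xs)"
  using assms by (intro inner_pointI) (auto simp: coords_in csum_coords sqsum_coords coords_apply)

lemma phi_coords:
  assumes "length ps = \<rho>" "length qs = \<rho>" "length xs = \<rho>"
    "a = 2 * lform \<rho> (coords ps) (coords xs) / lform \<rho> (coords ps) (coords qs)"
    "b = 2 * lform \<rho> (coords qs) (coords xs) / lform \<rho> (coords ps) (coords qs)"
  shows "phi \<rho> (coords ps) (coords qs) (coords xs)
      = coords (map2 (\<lambda>(p, q) x. a * q + b * p - x) (zip ps qs) xs)"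
  using assms(1-3)
  by (intro coords_eqI)
    (auto simp: phi_def assms(4,5) coords_apply coord_space_def add_divide_distrib distrib_left mult.assoc)

definition swap_list :: "nat \<Rightarrow> nat \<Rightarrow> real list \<Rightarrow> real list" where
  "swap_list i j xs = xs[i := xs ! j, j := xs ! i]"

lemma reflection_swap_coords:
  assumes "i < length xs" "j < length xs" "i \<noteq> j"
  shows "reflection (length xs) (bvec (Suc i) - bvec (Suc j)) (coords xs) = coords (swap_list i j xs)"
proof -
  have ij: "Suc i \<in> {1..length xs}" "Suc j \<in> {1..length xs}" using assms by auto
  have "lform (length xs) (bvec (Suc i) - bvec (Suc j)) (bvec (Suc i) - bvec (Suc j)) = 4"
    unfolding lform_bvec_diff[OF ij] using assms by (simp add: bvec_apply)
  then show ?thesis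
    using assms ij
    by (intro coords_eqI)
      (auto simp: reflection_def lform_bvec_diff swap_list_def coord_space_def coords_apply bvec_apply
        nth_list_update diff_divide_distrib)
qed

definition refl_u_list :: "real list \<Rightarrow> real list" where
  "refl_u_list xs = (let \<rho> = length xs;
     c = xs ! 0 - xs ! (\<rho> - 3) + xs ! (\<rho> - 2) + xs ! (\<rho> - 1) - sum_list xs
   in xs[0 := xs ! 0 - c, \<rho> - 3 := xs ! (\<rho> - 3) + c, \<rho> - 2 := xs ! (\<rho> - 2) - c,
         \<rho> - 1 := xs ! (\<rho> - 1) - c])"

lemma reflection_u_coords:
  assumes "length xs = \<rho>" "\<rho> \<ge> 4"
  shows "reflection \<rho> (bvec 1 - bvec (\<rho> - 2) + bvec (\<rho> - 1) + bvec \<rho>) (coords xs)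
    = coords (refl_u_list xs)"
proof -
  let ?u = "bvec 1 - bvec (\<rho> - 2) + bvec (\<rho> - 1) + bvec \<rho>"
  have sub: "{1, \<rho> - 2, \<rho> - 1, \<rho>} \<subseteq> {1..\<rho>}" using assms by auto
  have "distinct [1, \<rho> - 2, \<rho> - 1, \<rho>]" using assms(2) by auto
  then have "lform \<rho> ?u ?u = 4" by (rule lform_uvec_self[OF sub])
  moreover define c where "c = xs ! 0 - xs ! (\<rho> - 3) + xs ! (\<rho> - 2) + xs ! (\<rho> - 1) - sum_list xs"
  then have "lform \<rho> ?u (coords xs) = 2 * c"
    unfolding lform_uvec[OF sub] using assms
    by (simp add: csum_coords coords_apply numeral_eq_Suc)
  ultimately have r: "reflection \<rho> ?u (coords xs) = (\<lambda>i. coords xs i - c * ?u i)"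
    by (simp add: reflection_def)
  have l: "refl_u_list xs = xs[0 := xs ! 0 - c, \<rho> - 3 := xs ! (\<rho> - 3) + c,
      \<rho> - 2 := xs ! (\<rho> - 2) - c, \<rho> - 1 := xs ! (\<rho> - 1) - c]"
    using assms(1) by (simp add: refl_u_list_def Let_def c_def)
  \<comment> \<open>With rho = m + 4 the updated positions 0, m + 1, m + 2, m + 3 are visibly
    distinct.\<close>
  obtain m where m: "\<rho> = m + 4" using assms(2) by (metis add.commute le_Suc_ex)
  show ?thesis
    unfolding r l
  proof (rule coords_eqI)
    show "(\<lambda>i. coords xs i - c * ?u i) \<in> coord_space (length (xs[0 := xs ! 0 - c,
      \<rho> - 3 := xs ! (\<rho> - 3) + c, \<rho> - 2 := xs ! (\<rho> - 2) - c, \<rho> - 1 := xs ! (\<rho> - 1) - c]))"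
      using assms coords_in[OF assms(1)] bvec_in[of _ \<rho>]
      by (simp add: coord_space_simps)
  next
    fix k assume "k < length (xs[0 := xs ! 0 - c, \<rho> - 3 := xs ! (\<rho> - 3) + c,
      \<rho> - 2 := xs ! (\<rho> - 2) - c, \<rho> - 1 := xs ! (\<rho> - 1) - c])"
    then have k: "k < m + 4" using assms(1) m by simp
    consider "k = 0" | "k = m + 1" | "k = m + 2" | "k = m + 3"
      | "k \<noteq> 0" "k \<noteq> m + 1" "k \<noteq> m + 2" "k \<noteq> m + 3" by blast
    then show "coords xs (Suc k) - c * ?u (Suc k) = xs[0 := xs ! 0 - c,
      \<rho> - 3 := xs ! (\<rho> - 3) + c, \<rho> - 2 := xs ! (\<rho> - 2) - c, \<rho> - 1 := xs ! (\<rho> - 1) - c] ! k"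
      using k assms(1)
      by cases (simp_all add: m coords_apply bvec_apply nth_list_update)
  qed
qed

text \<open>
  The simple roots are numbered along the order \<open>\<rho>, \<rho> - 1, 1, 2, \<dots>, \<rho> - 2\<close> of the coordinates
  (list positions count from 0); number \<open>\<rho> - 1\<close> is \<open>\<u>\<close>.
\<close>

definition letter :: "nat \<Rightarrow> real list \<Rightarrow> real list" where
  "letter k xs = (let \<rho> = length xs in
     if k = 0 then swap_list (\<rho> - 2) (\<rho> - 1) xs
     else if k = 1 then swap_list 0 (\<rho> - 2) xs
     else if k < \<rho> - 1 then swap_list (k - 2) (k - 1) xs
     else refl_u_list xs)"

lemma length_letter: "length (letter k xs) = length xs"
  by (simp add: letter_def swap_list_def refl_u_list_def Let_def)

lemma reachable_letter:
  assumes "\<rho> \<ge> 4" "gens_common \<rho> \<subseteq> G" "length xs = \<rho>" "coords xs \<in> reachable G w"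
  shows "coords (letter k xs) \<in> reachable G w"
proof -
  have step: "coords (swap_list i j xs) \<in> reachable G w"
    if "reflection \<rho> (bvec (Suc i) - bvec (Suc j)) \<in> gens_common \<rho>" "i < \<rho>" "j < \<rho>" "i \<noteq> j" for i j
    using reach_step[OF assms(4), of "reflection \<rho> (bvec (Suc i) - bvec (Suc j))"]
      reflection_swap_coords[of i xs j] that assms by auto
  have u: "coords (refl_u_list xs) \<in> reachable G w"
    using reach_step[OF assms(4), of "reflection \<rho> (bvec 1 - bvec (\<rho> - 2) + bvec (\<rho> - 1) + bvec \<rho>)"]
      reflection_u_coords[OF assms(3,1)] assms(2) by (auto simp: gens_common_def)
  consider "k = 0" | "k = 1" | "k \<ge> 2" "k < \<rho> - 1" | "k \<ge> 2" "\<not> k < \<rho> - 1" by linarith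
  then show ?thesis
  proof cases
    case 1
    have "Suc (\<rho> - 2) = \<rho> - 1" "Suc (\<rho> - 1) = \<rho>" using assms(1) by auto
    then have "reflection \<rho> (bvec (Suc (\<rho> - 2)) - bvec (Suc (\<rho> - 1))) \<in> gens_common \<rho>"
      by (simp add: gens_common_def)
    then show ?thesis
      using step[of "\<rho> - 2" "\<rho> - 1"] 1 assms by (simp add: letter_def)
  next
    case 2
    have "Suc (\<rho> - 2) = \<rho> - 1" using assms(1) by auto
    then have "reflection \<rho> (bvec (Suc 0) - bvec (Suc (\<rho> - 2))) \<in> gens_common \<rho>"
      by (simp add: gens_common_def)
    then show ?thesis
      using step[of 0 "\<rho> - 2"] 2 assms by (simp add: letter_def)
  next
    case 3
    have "reflection \<rho> (bvec (Suc (k - 2)) - bvec (Suc (k - 1))) \<in> gens_common \<rho>"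
      using 3 assms(1) unfolding gens_common_def
      by (intro UnI1 CollectI exI[of _ "k - 1"]) (auto simp: Suc_diff_Suc numeral_2_eq_2)
    then show ?thesis
      using step[of "k - 2" "k - 1"] 3 assms by (simp add: letter_def)
  next
    case 4
    then show ?thesis using u assms by (simp add: letter_def)
  qed
qed

lemma reachable_fold_letter:
  assumes "\<rho> \<ge> 4" "gens_common \<rho> \<subseteq> G" "length xs = \<rho>" "coords xs \<in> reachable G w"
  shows "coords (fold letter ks xs) \<in> reachable G w"
  using assms(3,4)
proof (induction ks arbitrary: xs)
  case (Cons k ks)
  then show ?case using reachable_letter[OF assms(1,2)] by (simp add: length_letter)
qed simp

text \<open>The mirror image of w is w plus a positive multiple of v, so minimality against this
  single point is the wall inequality for v.\<close>

lemma reachable_reflection_sign: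
  assumes "reflection \<rho> v w \<in> reachable G w" "lform \<rho> v v = 4"
    "\<And>w'. w' \<in> reachable G w \<Longrightarrow> lform \<rho> w' n \<le> lform \<rho> w n" "lform \<rho> v w < 0"
  shows "lform \<rho> v n \<le> 0"
proof -
  have "lform \<rho> (reflection \<rho> v w) n = lform \<rho> w n - (lform \<rho> v w / 2) * lform \<rho> v n"
    unfolding reflection_def assms(2) by (simp add: lform_simps)
  then have "lform \<rho> v w * lform \<rho> v n \<ge> 0" using assms(3)[OF assms(1)] by simp
  then show ?thesis using assms(4) by (simp add: zero_le_mult_iff)
qed

text \<open>
  Here \<open>a1 \<ge> a2 \<ge> \<dots>\<close> are the coordinates \<open>x \<rho>, x (\<rho> - 1), x 1, x 2, \<dots>\<close>. The decompositions into products of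
  nonnegative linear forms are solutions of a linear program.
\<close>

lemma cone_ineq_4:
  fixes a1 a2 a3 a4 :: real
  assumes "a2 \<le> a1" "a3 \<le> a2" "a4 \<le> a3"
    "a3 - a4 + a2 + a1 \<le> a1 + a2 + a3 + a4" "2 * a1 \<le> a1 + a2 + a3 + a4"
  shows "2 * (a1\<^sup>2 + a2\<^sup>2 + a3\<^sup>2 + a4\<^sup>2) \<le> (a1 + a2 + a3 + a4)\<^sup>2"
proof -
  have "((a1 + a2 + a3 + a4)\<^sup>2 - 2 * (a1\<^sup>2 + a2\<^sup>2 + a3\<^sup>2 + a4\<^sup>2))
    = (a3 - a4) * (a1 + 3 * a2 - a3 + 9 * a4)
      + (2 * a4) * (a1 + 3 * a2 - 4 * a3 + 4 * a4)
      + (a1 - a2) * (- a1 + a2 + a3 + a4)"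
    by algebra
  also have "\<dots> \<ge> 0"
    by ((rule add_nonneg_nonneg)+; rule mult_nonneg_nonneg; use assms in linarith)
  finally show ?thesis by simp
qed

lemma cone_ineq_5:
  fixes a1 a2 a3 a4 a5 :: real
  assumes "a2 \<le> a1" "a3 \<le> a2" "a4 \<le> a3" "a5 \<le> a4"
    "a3 - a5 + a2 + a1 \<le> a1 + a2 + a3 + a4 + a5" "2 * a1 \<le> a1 + a2 + a3 + a4 + a5"
  shows "2 * (a1\<^sup>2 + a2\<^sup>2 + a3\<^sup>2 + a4\<^sup>2 + a5\<^sup>2) \<le> (a1 + a2 + a3 + a4 + a5)\<^sup>2"
proof -
  \<comment> \<open>Every first factor is the slack of a hypothesis, with a4 + 2 * a5 coming from
    the root u. The second factors are nonnegative combinations of slacks. The factor 3 clears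
    denominators.\<close>
  have "3 * ((a1 + a2 + a3 + a4 + a5)\<^sup>2 - 2 * (a1\<^sup>2 + a2\<^sup>2 + a3\<^sup>2 + a4\<^sup>2 + a5\<^sup>2))
    = (a3 - a4) * (3 * a1 + 9 * a2 - 3 * a3 + 27 * a4 + 18 * a5)
      + (a4 + 2 * a5) * (3 * a1 + 9 * a2 - 12 * a3 + 19 * a4 - 4 * a5)
      + (a4 - a5) * (3 * a1 + 9 * a2 - 12 * a3 + 5 * a4 - 5 * a5)
      + (a1 - a2) * (- 3 * a1 + 3 * a2 + 3 * a3 + 3 * a4 + 3 * a5)"
    by algebra
  also have "\<dots> \<ge> 0"
    by ((rule add_nonneg_nonneg)+; rule mult_nonneg_nonneg; use assms in linarith)
  finally show ?thesis by simp
qed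

lemma cone_ineq_6:
  fixes a1 a2 a3 a4 a5 a6 :: real
  assumes "a2 \<le> a1" "a3 \<le> a2" "a4 \<le> a3" "a5 \<le> a4" "a6 \<le> a5"
    "a3 - a6 + a2 + a1 \<le> a1 + a2 + a3 + a4 + a5 + a6" "2 * a1 \<le> a1 + a2 + a3 + a4 + a5 + a6"
  shows "2 * (a1\<^sup>2 + a2\<^sup>2 + a3\<^sup>2 + a4\<^sup>2 + a5\<^sup>2 + a6\<^sup>2) \<le> (a1 + a2 + a3 + a4 + a5 + a6)\<^sup>2"
proof -
  have "2 * ((a1 + a2 + a3 + a4 + a5 + a6)\<^sup>2 - 2 * (a1\<^sup>2 + a2\<^sup>2 + a3\<^sup>2 + a4\<^sup>2 + a5\<^sup>2 + a6\<^sup>2))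
    = (a5 - a6) * (2 * a1 + 6 * a2 - 2 * a3 + 10 * a4 + 2 * a5 + 14 * a6)
      + (a3 - a4) * (2 * a1 + 6 * a2 - 2 * a3 + 18 * a4 + 6 * a5 + 18 * a6)
      + (a4 + a5 + 2 * a6) * (2 * a1 + 6 * a2 - 8 * a3 + 13 * a4 - 7 * a5 + 6 * a6)
      + (a4 - a5) * (2 * a1 + 6 * a2 - 8 * a3 + 3 * a4 - 3 * a5)
      + (a1 - a2) * (- 2 * a1 + 2 * a2 + 2 * a3 + 2 * a4 + 2 * a5 + 2 * a6)"
    by algebra
  also have "\<dots> \<ge> 0"
    by ((rule add_nonneg_nonneg)+; rule mult_nonneg_nonneg; use assms in linarith)
  finally show ?thesis by simp
qed

lemma cone_ineq_7:
  fixes a1 a2 a3 a4 a5 a6 a7 :: real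
  assumes "a2 \<le> a1" "a3 \<le> a2" "a4 \<le> a3" "a5 \<le> a4" "a6 \<le> a5" "a7 \<le> a6"
    "a3 - a7 + a2 + a1 \<le> a1 + a2 + a3 + a4 + a5 + a6 + a7" "2 * a1 \<le> a1 + a2 + a3 + a4 + a5 + a6 + a7"
  shows "2 * (a1\<^sup>2 + a2\<^sup>2 + a3\<^sup>2 + a4\<^sup>2 + a5\<^sup>2 + a6\<^sup>2 + a7\<^sup>2) \<le> (a1 + a2 + a3 + a4 + a5 + a6 + a7)\<^sup>2"
proof -
  have "5 * ((a1 + a2 + a3 + a4 + a5 + a6 + a7)\<^sup>2 - 2 * (a1\<^sup>2 + a2\<^sup>2 + a3\<^sup>2 + a4\<^sup>2 + a5\<^sup>2 + a6\<^sup>2 + a7\<^sup>2))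
    = (a4 + a5 + a6 + 2 * a7) * (5 * a1 + 15 * a2 + 10 * a3 + 3 * a4 + 3 * a5 + 3 * a6 - 4 * a7)
      + (a3 - a4) * (5 * a1 + 15 * a2 - 5 * a3 + 15 * a4 - 30 * a7)
      + (a5 - a6) * (5 * a1 + 15 * a2 - 20 * a3 + 18 * a4 - 15 * a5 + 11 * a6 - 14 * a7)
      + (a6 - a7) * (5 * a1 + 15 * a2 - 20 * a3 + 22 * a4 - 22 * a5 + 3 * a6 - 3 * a7)
      + (a4 - a5) * (5 * a1 + 15 * a2 - 20 * a3 + 7 * a4 - 7 * a5)
      + (a1 - a2) * (- 5 * a1 + 5 * a2 + 5 * a3 + 5 * a4 + 5 * a5 + 5 * a6 + 5 * a7)"
    by algebra
  also have "\<dots> \<ge> 0"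
    by ((rule add_nonneg_nonneg)+; rule mult_nonneg_nonneg; use assms in linarith)
  finally show ?thesis by simp
qed

lemma cone_ineq_8:
  fixes a1 a2 a3 a4 a5 a6 a7 a8 :: real
  assumes "a2 \<le> a1" "a3 \<le> a2" "a4 \<le> a3" "a5 \<le> a4" "a6 \<le> a5" "a7 \<le> a6" "a8 \<le> a7"
    "a3 - a8 + a2 + a1 \<le> a1 + a2 + a3 + a4 + a5 + a6 + a7 + a8"
    "2 * a1 \<le> a1 + a2 + a3 + a4 + a5 + a6 + a7 + a8"
  shows "2 * (a1\<^sup>2 + a2\<^sup>2 + a3\<^sup>2 + a4\<^sup>2 + a5\<^sup>2 + a6\<^sup>2 + a7\<^sup>2 + a8\<^sup>2)
      \<le> (a1 + a2 + a3 + a4 + a5 + a6 + a7 + a8)\<^sup>2"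
proof -
  have "3 * ((a1 + a2 + a3 + a4 + a5 + a6 + a7 + a8)\<^sup>2
        - 2 * (a1\<^sup>2 + a2\<^sup>2 + a3\<^sup>2 + a4\<^sup>2 + a5\<^sup>2 + a6\<^sup>2 + a7\<^sup>2 + a8\<^sup>2))
    = (a7 - a8) * (3 * a1 + 9 * a2 + 6 * a3 + 6 * a4 + 6 * a5 + 6 * a6 + 5 * a7 + 19 * a8)
      + (a4 + a5 + a6 + a7 + 2 * a8)
              * (3 * a1 + 9 * a2 + 6 * a3 + 2 * a4 + 2 * a5 + 2 * a6 - 8 * a7 + 8 * a8)
      + (a5 - a6) * (3 * a1 + 9 * a2 + 6 * a3 - 8 * a4 - 9 * a5 + 5 * a6 - 6 * a7)
      + (a3 - a4) * (3 * a1 + 9 * a2 - 3 * a3 + 9 * a4 - 18 * a5 + 18 * a6 - 18 * a7)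
      + (a4 - a5) * (3 * a1 + 9 * a2 - 12 * a3 + 4 * a4 - 4 * a5 + 12 * a6 - 12 * a7)
      + (a6 - a7) * (3 * a1 + 9 * a2 - 12 * a3)
      + (a1 - a2) * (- 3 * a1 + 3 * a2 + 3 * a3 + 3 * a4 + 3 * a5 + 3 * a6 + 3 * a7 + 3 * a8)"
    by algebra
  also have "\<dots> \<ge> 0"
    by ((rule add_nonneg_nonneg)+; rule mult_nonneg_nonneg; use assms in linarith)
  finally show ?thesis by simp
qed

text \<open>The last two hypotheses cut off rays of the chamber such as a = (3,3,3,3,3,3,3,-4,-4),
  of norm 21. Multiplied by 7, their left sides are the cofactors of a6 - a7 and a7 - a8.\<close>

lemma cone_ineq_9:
  fixes a1 a2 a3 a4 a5 a6 a7 a8 a9 :: real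
  assumes "a2 \<le> a1" "a3 \<le> a2" "a4 \<le> a3" "a5 \<le> a4" "a6 \<le> a5" "a7 \<le> a6" "a8 \<le> a7" "a9 \<le> a8"
    "a3 - a9 + a2 + a1 \<le> a1 + a2 + a3 + a4 + a5 + a6 + a7 + a8 + a9"
    "2 * a1 \<le> a1 + a2 + a3 + a4 + a5 + a6 + a7 + a8 + a9"
    "a1 + a2 + a3 + a4 + a5 + a6 + 3 * a7 + 3 * a8 + 3 * a9 \<ge> 0"
    "a1 + a2 + a3 + a4 + a5 + a6 + a7 + 3 * a8 + 3 * a9 \<ge> 0"
  shows "2 * (a1\<^sup>2 + a2\<^sup>2 + a3\<^sup>2 + a4\<^sup>2 + a5\<^sup>2 + a6\<^sup>2 + a7\<^sup>2 + a8\<^sup>2 + a9\<^sup>2)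
      \<le> (a1 + a2 + a3 + a4 + a5 + a6 + a7 + a8 + a9)\<^sup>2"
proof -
  have "7 * ((a1 + a2 + a3 + a4 + a5 + a6 + a7 + a8 + a9)\<^sup>2
        - 2 * (a1\<^sup>2 + a2\<^sup>2 + a3\<^sup>2 + a4\<^sup>2 + a5\<^sup>2 + a6\<^sup>2 + a7\<^sup>2 + a8\<^sup>2 + a9\<^sup>2))
    = (a8 - a9) * (7 * a1 + 21 * a2 + 14 * a3 + 14 * a4 + 14 * a5 + 5 * a6 + 18 * a7 + 18 * a8 + 43 * a9)
      + (a3 - a4)
              * (7 * a1 + 21 * a2 - 7 * a3 + 63 * a4 + 42 * a5 + 21 * a6 + 42 * a7 + 21 * a8 + 84 * a9)
      + (a4 - a5)
              * (7 * a1 + 21 * a2 - 28 * a3 + 47 * a4 + 51 * a5 + 29 * a6 + 40 * a7 + 23 * a8 + 76 * a9)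
      + (a4 + a5 + a6 + a7 + a8 + 2 * a9)
              * (7 * a1 + 21 * a2 - 28 * a3 + 9 * a4 + 43 * a5 - 10 * a6 + 7 * a7 - 4 * a8 + 18 * a9)
      + (a5 - a6) * (7 * a1 + 21 * a2 - 28 * a3 + a5 + 4 * a6 + 4 * a7 - 9 * a8)
      + (a2 - a3) * (14 * a6 - 14 * a8)
      + (a7 - a8) * (7 * a1 + 7 * a2 + 7 * a3 + 7 * a4 + 7 * a5 + 7 * a6 + 7 * a7 + 21 * a8 + 21 * a9)
      + (a1 - a2) * (- 7 * a1 + 7 * a2 + 7 * a3 + 7 * a4 + 7 * a5 + 7 * a6 + 7 * a7 + 7 * a8 + 7 * a9)
      + (a6 - a7) * (7 * a1 + 7 * a2 + 7 * a3 + 7 * a4 + 7 * a5 + 7 * a6 + 21 * a7 + 21 * a8 + 21 * a9)"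
    by algebra
  also have "\<dots> \<ge> 0"
    by ((rule add_nonneg_nonneg)+; rule mult_nonneg_nonneg; use assms in linarith)
  finally show ?thesis by simp
qed

text \<open>The first of the three additional hypotheses is the wall of the extra reflection, the
  other two come from words containing maps phi. Multiplied by 126, their left sides are the
  cofactors of a7 - a8, a6 - a7 and a8 - a9.\<close>

lemma cone_ineq_10:
  fixes a1 a2 a3 a4 a5 a6 a7 a8 a9 a10 :: real
  assumes "a2 \<le> a1" "a3 \<le> a2" "a4 \<le> a3" "a5 \<le> a4" "a6 \<le> a5" "a7 \<le> a6" "a8 \<le> a7" "a9 \<le> a8" "a10 \<le> a9"
    "a3 - a10 + a2 + a1 \<le> a1 + a2 + a3 + a4 + a5 + a6 + a7 + a8 + a9 + a10"
    "2 * a1 \<le> a1 + a2 + a3 + a4 + a5 + a6 + a7 + a8 + a9 + a10"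
    "a1 + a2 + a3 + a4 + a5 + a6 + a7 + 3 * a8 + 3 * a9 + 3 * a10 \<ge> 0"
    "a1 + a2 + a3 + a4 + a5 + a6 + 3 * a7 + 3 * a8 + 3 * a9 + 3 * a10 \<ge> 0"
    "a1 + a2 + a3 + a4 + a5 + a6 + a7 + a8 + 3 * a9 + 3 * a10 \<ge> 0"
  shows "2 * (a1\<^sup>2 + a2\<^sup>2 + a3\<^sup>2 + a4\<^sup>2 + a5\<^sup>2 + a6\<^sup>2 + a7\<^sup>2 + a8\<^sup>2 + a9\<^sup>2 + a10\<^sup>2)
      \<le> (a1 + a2 + a3 + a4 + a5 + a6 + a7 + a8 + a9 + a10)\<^sup>2"
proof -
  have "126 * ((a1 + a2 + a3 + a4 + a5 + a6 + a7 + a8 + a9 + a10)\<^sup>2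
        - 2 * (a1\<^sup>2 + a2\<^sup>2 + a3\<^sup>2 + a4\<^sup>2 + a5\<^sup>2 + a6\<^sup>2 + a7\<^sup>2 + a8\<^sup>2 + a9\<^sup>2 + a10\<^sup>2))
    = (a4 + a5 + a6 + a7 + a8 + a9 + 2 * a10)
            * (126 * a1 + 378 * a2 - 126 * a3 + 270 * a4 + 297 * a5 - 189 * a6 + 126 * a7 + 126 * a8 + 315 * a9 - 63 * a10)
      + (a4 - a5)
              * (126 * a1 + 378 * a2 - 126 * a3 - 18 * a4 + 423 * a5 + 45 * a6 + 234 * a7 + 234 * a8 + 549 * a9 - 225 * a10)
      + (a9 - a10)
              * (126 * a1 + 378 * a2 - 126 * a3 - 378 * a4 + 504 * a5 - 315 * a6 - 63 * a7 - 63 * a8 - 63 * a9)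
      + (a5 - a6) * (126 * a1 + 378 * a2 - 126 * a3 - 378 * a4 + 63 * a6 + 63 * a7 + 63 * a8 - 189 * a9)
      + (a2 - a3) * (504 * a3 - 504 * a4 + 252 * a6 - 252 * a9)
      + (a1 - a2)
              * (- 126 * a1 + 126 * a2 + 630 * a3 - 378 * a4 + 126 * a5 + 126 * a6 + 126 * a7 + 126 * a8 + 126 * a9 + 126 * a10)
      + (a6 - a7)
              * (126 * a1 + 126 * a2 + 126 * a3 + 126 * a4 + 126 * a5 + 126 * a6 + 378 * a7 + 378 * a8 + 378 * a9 + 378 * a10)
      + (a3 - a4)
              * (- 378 * a1 + 378 * a2 + 378 * a3 + 378 * a4 + 378 * a5 + 378 * a6 + 378 * a7 + 378 * a8 + 378 * a9 + 378 * a10)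
      + (a7 - a8)
              * (126 * a1 + 126 * a2 + 126 * a3 + 126 * a4 + 126 * a5 + 126 * a6 + 126 * a7 + 378 * a8 + 378 * a9 + 378 * a10)
      + (a8 - a9)
              * (126 * a1 + 126 * a2 + 126 * a3 + 126 * a4 + 126 * a5 + 126 * a6 + 126 * a7 + 126 * a8 + 378 * a9 + 378 * a10)"
    by algebra
  also have "\<dots> \<ge> 0"
    by ((rule add_nonneg_nonneg)+; rule mult_nonneg_nonneg; use assms in linarith)
  finally show ?thesis by simp
qed

section \<open>The seven cases\<close>

lemma reflection_uminus: "reflection \<rho> (- v) = reflection \<rho> v"
  by (simp add: reflection_def lform_simps fun_eq_iff)

text \<open>The inequality \<open>2 * n \<rho> \<le> csum \<rho> n\<close> is e_rho . n \<le> 0. If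
  it holds, n is in the light cone, against n . n = 1; if it fails, outermost vectors with positive
  pairing coincide.\<close>

lemma minimal_eq_bvec:
  assumes "\<rho> \<ge> 3" "n \<in> E1_star \<rho>"
    "2 * n \<rho> \<le> csum \<rho> n \<Longrightarrow> 2 * sqsum \<rho> n \<le> (csum \<rho> n)\<^sup>2"
  shows "n = bvec \<rho>"
proof -
  have n: "lform \<rho> n n = 1" using E1_star_E1[OF assms(2)] assms(1) by (simp add: E1_iff)
  then have "lform \<rho> (bvec \<rho>) n > 0"
    using assms(1,3) by (force simp: lform_self lform_bvec_left)
  then show ?thesis
    using E1_star_lform_le[OF assms(1) bvec_E1_star assms(2), of \<rho>] assms(1) by force
qed

text \<open>The numerical conditions place w strictly inside a chamber of the reflections in
  \<open>gens_common\<close>; a minimal n lies in the closure of the same chamber.\<close>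

lemma minimal_dominant:
  assumes "\<rho> \<ge> 4" "gens_common \<rho> \<subseteq> G" "length ws = \<rho>"
    "\<And>w'. w' \<in> reachable G (coords ws) \<Longrightarrow> lform \<rho> w' n \<le> lform \<rho> (coords ws) n"
    "ws ! (\<rho> - 2) < ws ! (\<rho> - 1)" "ws ! 0 < ws ! (\<rho> - 2)" "\<forall>i<\<rho> - 3. ws ! Suc i < ws ! i"
    "ws ! 0 - ws ! (\<rho> - 3) + ws ! (\<rho> - 2) + ws ! (\<rho> - 1) < sum_list ws"
  shows "n (\<rho> - 1) \<le> n \<rho>" "n 1 \<le> n (\<rho> - 1)" "\<And>i. i \<in> {1..\<rho> - 3} \<Longrightarrow> n (i + 1) \<le> n i"
    "n 1 - n (\<rho> - 2) + n (\<rho> - 1) + n \<rho> \<le> csum \<rho> n"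
proof -
  have swap: "n i \<le> n j"
    if "reflection \<rho> (bvec i - bvec j) \<in> G \<or> reflection \<rho> (bvec j - bvec i) \<in> G"
      "i \<in> {1..\<rho>}" "j \<in> {1..\<rho>}" "ws ! (i - 1) < ws ! (j - 1)" for i j
  proof -
    have "i \<noteq> j" using that(4) by auto
    \<comment> \<open>The roots e_i - e_(i+1) along the coordinates 1, ..., rho - 2 pair positively
      with w, so their negatives are used.\<close>
    have "reflection \<rho> (bvec j - bvec i) = reflection \<rho> (bvec i - bvec j)"
      using reflection_uminus[of \<rho> "bvec i - bvec j"] by simp
    with that(1) have "reflection \<rho> (bvec i - bvec j) (coords ws) \<in> reachable G (coords ws)"
      using reach_step[OF reach_refl] by metis
    moreover have "lform \<rho> (bvec i - bvec j) (bvec i - bvec j) = 4"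
      using that \<open>i \<noteq> j\<close> by (simp add: lform_bvec_diff bvec_apply)
    moreover have "lform \<rho> (bvec i - bvec j) (coords ws) < 0"
      using that assms(3) by (simp add: lform_bvec_diff coords_apply)
    ultimately have "lform \<rho> (bvec i - bvec j) n \<le> 0"
      using reachable_reflection_sign assms(4) by blast
    then show ?thesis using that by (simp add: lform_bvec_diff)
  qed
  note gens = subsetD[OF assms(2)]
  show "n (\<rho> - 1) \<le> n \<rho>"
    using assms(1,5) by (intro swap disjI1 gens) (auto simp: gens_common_def numeral_2_eq_2)
  show "n 1 \<le> n (\<rho> - 1)"
    using assms(1,6) by (intro swap disjI1 gens) (auto simp: gens_common_def numeral_2_eq_2)
  show "n (i + 1) \<le> n i" if "i \<in> {1..\<rho> - 3}" for i
  proof (intro swap disjI2 gens)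
    show "reflection \<rho> (bvec i - bvec (i + 1)) \<in> gens_common \<rho>"
      using that by (auto simp: gens_common_def)
    show "ws ! (i + 1 - 1) < ws ! (i - 1)" using assms(1) assms(7)[rule_format, of "i - 1"] that by auto
  qed (use that assms(1) in auto)
  let ?u = "bvec 1 - bvec (\<rho> - 2) + bvec (\<rho> - 1) + bvec \<rho>"
  have sub: "{1, \<rho> - 2, \<rho> - 1, \<rho>} \<subseteq> {1..\<rho>}" using assms(1) by auto
  have "reflection \<rho> ?u (coords ws) \<in> reachable G (coords ws)"
    using reach_step[OF reach_refl, of "reflection \<rho> ?u" G "coords ws"] assms(2)
    by (auto simp: gens_common_def)
  moreover have "lform \<rho> ?u ?u = 4"
    using assms(1) by (intro lform_uvec_self[OF sub]) auto
  moreover have "lform \<rho> ?u (coords ws) < 0"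
  proof -
    have "\<rho> - 2 - 1 = \<rho> - 3" "\<rho> - 1 - 1 = \<rho> - 2" "1 \<le> \<rho> - 2" "1 \<le> \<rho> - 1" "1 \<le> \<rho>"
      using assms(1) by auto
    then show ?thesis
      unfolding lform_uvec[OF sub] using assms(3,8) by (simp add: csum_coords coords_apply)
  qed
  ultimately have "lform \<rho> ?u n \<le> 0" using reachable_reflection_sign assms(4) by blast
  then show "n 1 - n (\<rho> - 2) + n (\<rho> - 1) + n \<rho> \<le> csum \<rho> n"
    unfolding lform_uvec[OF sub] by simp
qed

text \<open>The summands are ordered like the variables of \<open>cone_ineq_4\<close>, \<open>cone_ineq_5\<close>, \<dots>.\<close>

lemma sum_expand:
  fixes f :: "nat \<Rightarrow> real"
  shows
  "(\<Sum>i=1..4. f i) = f 4 + f 3 + f 1 + f 2"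
  "(\<Sum>i=1..5. f i) = f 5 + f 4 + f 1 + f 2 + f 3"
  "(\<Sum>i=1..6. f i) = f 6 + f 5 + f 1 + f 2 + f 3 + f 4"
  "(\<Sum>i=1..7. f i) = f 7 + f 6 + f 1 + f 2 + f 3 + f 4 + f 5"
  "(\<Sum>i=1..8. f i) = f 8 + f 7 + f 1 + f 2 + f 3 + f 4 + f 5 + f 6"
  "(\<Sum>i=1..9. f i) = f 9 + f 8 + f 1 + f 2 + f 3 + f 4 + f 5 + f 6 + f 7"
  "(\<Sum>i=1..10. f i) = f 10 + f 9 + f 1 + f 2 + f 3 + f 4 + f 5 + f 6 + f 7 + f 8"
  by (simp_all add: numeral_eq_Suc)

lemma Evec_coords:
  "Evec 9 = coords [0, 0, 0, 0, 0, 0, 0, 1, 1]"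
  "Evec 10 = coords [0, 0, 0, 0, 0, 0, 0, 0, 1, 1]"
  by (auto simp: Evec_def bvec_apply coords_apply fun_eq_iff nth_Cons')

lemma K_symmetry_phi_coords:
  assumes "\<rho> \<ge> 3" "length ps = \<rho>" "length qs = \<rho>"
    "lform \<rho> (coords ps) (coords ps) = 0" "lform \<rho> (coords qs) (coords qs) = 0"
    "lform \<rho> (coords ps) (coords qs) \<noteq> 0"
    "\<And>x. x \<in> lattice \<rho> \<Longrightarrow> phi \<rho> (coords ps) (coords qs) x \<in> lattice \<rho>"
    "inner_point \<rho> (coords (map2 (\<lambda>x y. a * x + b * y) ps qs))"
  shows "K_symmetry \<rho> (phi \<rho> (coords ps) (coords qs))"
  using assms coords_lincomb[of ps qs a b] coords_in[OF assms(2)] coords_in[OF assms(3)]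
  by (intro K_symmetry_phi[where a = a and b = b]) auto

section \<open>The additional generators for rho = 9 and rho = 10\<close>

lemma K_symmetry_gens_9:
  assumes "g \<in> Gamma_gens 9"
  shows "K_symmetry 9 g"
proof -
  let ?P1 = "coords [1, 1, 1, 1, 0, -1, -1, 1, 1]"
  let ?P2 = "coords [1, 1, 1, 1, 2, -1, -2, 1, 2]"
  have "K_symmetry 9 (phi 9 ?P1 (Evec 9))"
    unfolding Evec_coords
    by (intro K_symmetry_phi_coords[where a = 1 and b = 1] phi_lattice_4 inner_point_coords)
      (simp_all add: lform_coords csum_coords coords_lattice)
  moreover have "K_symmetry 9 (phi 9 ?P1 ?P2)"
  proof (intro K_symmetry_phi_coords[where a = 1 and b = 1] phi_lattice_4)
    \<comment> \<open>This is P1 + P2, with coordinate sum 10 and square sum 46. The criterion fails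
      for s = 3 (920 against 900) but holds for s = 5 (2392 against 2500), so the sums 1 and 3
      remain to be treated.\<close>
    let ?q = "coords [2, 2, 2, 2, 2, -2, -3, 2, 3]"
    have "lform 9 m ?q < 0" if m: "m \<in> E1 9" for m
    proof (rule ccontr)
      assume neg: "\<not> ?thesis"
      then have "csum 9 m < 5"
        using m by (intro E1_csum_less[where q = ?q]) (auto simp: coords_in csum_coords sqsum_coords)
      moreover obtain k :: int where k: "odd k" "csum 9 m = of_int k"
        using lform_odd(1)[of m 9 m] m by (auto simp: E1_iff)
      moreover have "csum 9 m \<ge> 1" using E1_csum_ge_1[of 9 m] m by simp
      ultimately have "k < 5" "1 \<le> k" by simp_all
      with k(1) have "k = 1 \<or> k = 3" by presburger
      then show False
      proof
        assume "k = 1"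
        then have "csum 9 m = 1" using k by simp
        then obtain i where i: "i \<in> {1..9}" "m = bvec i"
          using E1_csum_1[OF _ m] by auto
        have "\<forall>x\<in>set [2, 2, 2, 2, 2, -2, -3, 2, 3]. 2 * x < (10 :: real)" by simp
        then have "2 * ?q i < 10" using i(1) unfolding coords_apply by (auto simp del: set_simps)
        then show False using neg i by (simp add: lform_bvec_left csum_coords)
      next
        assume "k = 3"
        then have s: "csum 9 m = 3" using k by simp
        \<comment> \<open>Cauchy-Schwarz just fails here, so integrality is used in each coordinate.\<close>
        then have sq: "sqsum 9 m = 5" using m by (simp add: E1_iff lform_self)
        have I: "m j \<in> \<int>" for j using m by (simp add: E1_def lattice_def)
        have mult: "m j * (m j - 1) \<ge> 0" "m j * (m j + 1) \<ge> 0" "(m j + 1) * (m j + 2) \<ge> 0"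
          "(m j - 1)\<^sup>2 \<ge> 0" "(m j + 1)\<^sup>2 \<ge> 0" for j
        proof -
          obtain z :: int where z: "m j = of_int z" using I[of j] by (auto elim: Ints_cases)
          have "z * (z - 1) \<ge> 0" "z * (z + 1) \<ge> 0" "(z + 1) * (z + 2) \<ge> 0"
            by (auto simp: zero_le_mult_iff)
          then have "of_int (z * (z - 1)) \<ge> (0 :: real)" "of_int (z * (z + 1)) \<ge> (0 :: real)"
            "of_int ((z + 1) * (z + 2)) \<ge> (0 :: real)" unfolding of_int_0_le_iff by auto
          then show "m j * (m j - 1) \<ge> 0" "m j * (m j + 1) \<ge> 0" "(m j + 1) * (m j + 2) \<ge> 0"
            by (simp_all add: z)
        qed simp_all
        \<comment> \<open>Bounds on q_j m_j valid at integers. Together with the sum 3 and the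
          square sum 5 they give at most 15/2 + 3/2 + 4 = 13 in total, whereas m . q \<ge> 0
          requires 15.\<close>
        have t: "2 * m j \<le> 3/2 * (m j)\<^sup>2 + m j / 2" "3 * m j \<le> 3/2 * (m j)\<^sup>2 + m j / 2 + 1"
          "-2 * m j \<le> 3/2 * (m j)\<^sup>2 + m j / 2 + 1" "-3 * m j \<le> 3/2 * (m j)\<^sup>2 + m j / 2 + 2" for j
          using mult[of j] by (simp_all add: power2_eq_square algebra_simps)
        have "lform 9 m ?q \<ge> 0" using neg by simp
        then show False
          using s sq t(1)[of 1] t(1)[of 2] t(1)[of 3] t(1)[of 4] t(1)[of 5] t(3)[of 6] t(4)[of 7]
            t(1)[of 8] t(2)[of 9]
          unfolding lform_def csum_def sqsum_def sum_expand by (simp add: coords_apply)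
      qed
    qed
    then have "inner_point 9 ?q"
      unfolding inner_point_def timelike_def
      by (auto simp: lform_self coords_in csum_coords sqsum_coords)
    then show "inner_point 9 (coords (map2 (\<lambda>x y. 1 * x + 1 * y)
        [1, 1, 1, 1, 0, -1, -1, 1, 1] [1, 1, 1, 1, 2, -1, -2, 1, 2]))"
      by simp
  qed (simp_all add: lform_coords csum_coords coords_lattice)
  ultimately show ?thesis
    using assms K_symmetry_gens_common[of 9 g] by (auto simp: Gamma_gens_def gens_extra_def Let_def)
qed

lemma K_symmetry_gens_10:
  assumes "g \<in> Gamma_gens 10"
  shows "K_symmetry 10 g"
proof -
  let ?n = "coords [1, 1, 1, 1, 1, -1, -1, -1, 1, 1]"
  let ?P1 = "coords [1, 1, 1, 1, 0, 0, -1, -1, 1, 1]"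
  let ?P2 = "coords [1, 1, 1, 1, 2, 2, -1, -3, 1, 3]"
  have "K_symmetry 10 (reflection 10 ?n)"
    \<comment> \<open>This q is D + 8 n, the projection of D to the mirror: n . D = -32 and n . n =
      4.\<close>
    by (intro K_symmetry_reflection[where q = "coords [9, 9, 9, 9, 9, -7, -7, -7, 9, 9]"]
        inner_point_coords)
      (simp_all add: lform_coords csum_coords coords_lattice)
  moreover have "K_symmetry 10 (phi 10 ?P1 (Evec 10))"
    unfolding Evec_coords
    by (intro K_symmetry_phi_coords[where a = 1 and b = 1] phi_lattice_4 inner_point_coords)
      (simp_all add: lform_coords csum_coords coords_lattice)
  moreover have "K_symmetry 10 (phi 10 ?P1 ?P2)"
  \<comment> \<open>Here P1 . P2 = -8, unlike the value -4 of the other maps phi; R is half of P2 -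
    P1.\<close>
  proof (intro K_symmetry_phi_coords[where a = 2 and b = 1]
      phi_lattice_8[where R = "coords [0, 0, 0, 0, 1, 1, 0, -1, 0, 1]"] inner_point_coords)
    show "?P2 = (\<lambda>i. ?P1 i + 2 * coords [0, 0, 0, 0, 1, 1, 0, -1, 0, 1] i)"
      using coords_lincomb[of "[1, 1, 1, 1, 0, 0, -1, -1, 1, 1]" "[0, 0, 0, 0, 1, 1, 0, -1, 0, 1]" 1 2]
      by simp
  qed (simp_all add: lform_coords csum_coords coords_lattice)
  ultimately show ?thesis
    using assms K_symmetry_gens_common[of 10 g] by (auto simp: Gamma_gens_def gens_extra_def Let_def)
qed

section \<open>Minimal vectors in each dimension\<close>

lemma packing_small:
  assumes "4 \<le> \<rho>" "\<rho> \<noteq> 9" "\<rho> \<noteq> 10" "length ws = \<rho>" "\<forall>x\<in>set ws. x \<in> \<int>"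
    "inner_point \<rho> (coords ws)"
    "ws ! (\<rho> - 2) < ws ! (\<rho> - 1)" "ws ! 0 < ws ! (\<rho> - 2)" "\<forall>i<\<rho> - 3. ws ! Suc i < ws ! i"
    "ws ! 0 - ws ! (\<rho> - 3) + ws ! (\<rho> - 2) + ws ! (\<rho> - 1) < sum_list ws"
    "\<And>n :: nat \<Rightarrow> real. n (\<rho> - 1) \<le> n \<rho> \<Longrightarrow> n 1 \<le> n (\<rho> - 1) \<Longrightarrow>
      (\<And>i. i \<in> {1..\<rho> - 3} \<Longrightarrow> n (i + 1) \<le> n i) \<Longrightarrow>
      n 1 - n (\<rho> - 2) + n (\<rho> - 1) + n \<rho> \<le> csum \<rho> n \<Longrightarrow> 2 * n \<rho> \<le> csum \<rho> n \<Longrightarrow>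
      2 * sqsum \<rho> n \<le> (csum \<rho> n)\<^sup>2"
  shows "packing_property \<rho>"
proof (rule packing_of_orbit)
  show \<rho>: "\<rho> \<ge> 3" using assms(1) by simp
  have gens: "Gamma_gens \<rho> = gens_common \<rho>"
    using assms(2,3) by (simp add: Gamma_gens_def gens_extra_def)
  then show "\<forall>g\<in>Gamma_gens \<rho>. K_symmetry \<rho> g"
    using K_symmetry_gens_common assms(1) by blast
  show "coords ws \<in> lattice \<rho>" using coords_lattice assms(4,5) by blast
  show "inner_point \<rho> (coords ws)" by fact
  fix n
  assume n: "n \<in> E1_star \<rho>"
    "\<And>w'. w' \<in> reachable (Gamma_gens \<rho>) (coords ws) \<Longrightarrow> lform \<rho> w' n \<le> lform \<rho> (coords ws) n"
  note dom = minimal_dominant[OF assms(1) subset_refl assms(4) n(2)[unfolded gens] assms(7-10)]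
  show "n = bvec \<rho>"
    using minimal_eq_bvec[OF \<rho> n(1)] assms(11)[of n] dom by blast
qed






text \<open>
  For \<open>\<rho> = 9\<close> and \<open>\<rho> = 10\<close> the chamber of the roots in \<open>gens_common\<close> has, besides \<open>bvec \<rho>\<close>, two further
  vertices outside the light cone. The point \<open>w\<close> pairs equally with all these roots, and the two words
  below carry it to its mirror images in the hyperplanes truncating these vertices, which is the
  source of the additional inequalities of \<open>cone_ineq_9\<close> and \<open>cone_ineq_10\<close>.
\<close>

lemma reachable_9:
  "coords [28, 27, 26, 25, 24, -33, -34, 29, 30]
      \<in> reachable (Gamma_gens 9) (coords [4, 3, 2, 1, 0, -1, -2, 5, 6])" (is ?first)
  "coords [36, 35, 34, 33, -24, -25, -26, 37, 38]
      \<in> reachable (Gamma_gens 9) (coords [4, 3, 2, 1, 0, -1, -2, 5, 6])" (is ?second)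
proof -
  let ?P1 = "coords [1, 1, 1, 1, 0, -1, -1, 1, 1]" and ?P2 = "coords [1, 1, 1, 1, 2, -1, -2, 1, 2]"
  have common: "gens_common 9 \<subseteq> Gamma_gens 9" by (simp add: Gamma_gens_def)
  have gens: "phi 9 ?P1 ?P2 \<in> Gamma_gens 9" "phi 9 ?P1 (Evec 9) \<in> Gamma_gens 9"
    by (simp_all add: Gamma_gens_def gens_extra_def Let_def)
  have "phi 9 ?P1 ?P2 (coords [4, 3, 2, 1, 0, -1, -2, 5, 6])
      = coords [30, 31, 32, 33, 24, -33, -44, 29, 40]"
    by (subst phi_coords[OF _ _ _ refl refl]) (simp_all add: lform_coords)
  \<comment> \<open>The image under phi has left the chamber of w; the word of simple reflections
    takes it back there.\<close>
  moreover have "fold letter [1, 2, 1, 3, 2, 1, 4, 3, 2, 1, 8, 2, 1, 3, 2, 4, 3, 8, 2, 1] [30, 31, 32, 33, 24, -33, -44, 29, 40] =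
      [28, 27, 26, 25, 24, -33, -34, 29, 30]"
    by (simp add: letter_def swap_list_def refl_u_list_def Let_def)
  ultimately show 1: ?first
    using reachable_fold_letter[OF _ common,
        of "[30, 31, 32, 33, 24, -33, -44, 29, 40]"
        _ "[1, 2, 1, 3, 2, 1, 4, 3, 2, 1, 8, 2, 1, 3, 2, 4, 3, 8, 2, 1]"]
      reach_step[OF reach_refl gens(1), of "coords [4, 3, 2, 1, 0, -1, -2, 5, 6]"]
    by simp
  have "phi 9 ?P1 (Evec 9) (coords [28, 27, 26, 25, 24, -33, -34, 29, 30])
      = coords [35, 36, 37, 38, -24, -30, -29, 46, 45]"
    unfolding Evec_coords by (subst phi_coords[OF _ _ _ refl refl]) (simp_all add: lform_coords)
  moreover have "fold letter [0, 2, 3, 2, 4, 3, 2, 7, 8, 2, 3, 4, 7, 8, 2, 3] [35, 36, 37, 38, -24, -30, -29, 46, 45] =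
      [36, 35, 34, 33, -24, -25, -26, 37, 38]"
    by (simp add: letter_def swap_list_def refl_u_list_def Let_def)
  ultimately show ?second
    using reachable_fold_letter[OF _ common,
        of "[35, 36, 37, 38, -24, -30, -29, 46, 45]"
        _ "[0, 2, 3, 2, 4, 3, 2, 7, 8, 2, 3, 4, 7, 8, 2, 3]"]
      reach_step[OF 1 gens(2)]
    by simp
qed

lemma minimal_9:
  assumes "\<And>w'. w'
      \<in> reachable (Gamma_gens 9) (coords [4, 3, 2, 1, 0, -1, -2, 5, 6]) \<Longrightarrow>
      lform 9 w' n \<le> lform 9 (coords [4, 3, 2, 1, 0, -1, -2, 5, 6]) n"
  shows "n 8 \<le> n 9" "n 1 \<le> n 8" "n 2 \<le> n 1" "n 3 \<le> n 2" "n 4 \<le> n 3" "n 5 \<le> n 4" "n 6 \<le> n 5" "n 7 \<le> n 6"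
    "n 1 - n 7 + n 8 + n 9 \<le> csum 9 n"
    "n 9 + n 8 + n 1 + n 2 + n 3 + n 4 + n 5 + 3 * n 6 + 3 * n 7 \<ge> 0"
    "n 9 + n 8 + n 1 + n 2 + n 3 + n 4 + 3 * n 5 + 3 * n 6 + 3 * n 7 \<ge> 0"
proof -
  have common: "gens_common 9 \<subseteq> Gamma_gens 9" by (simp add: Gamma_gens_def)
  have dec: "\<forall>i<9 - 3. ([4, 3, 2, 1, 0, -1, -2, 5, 6] :: real list) ! Suc i
      < [4, 3, 2, 1, 0, -1, -2, 5, 6] ! i"
    by (simp add: numeral_eq_Suc All_less_Suc)
  note dom = minimal_dominant[OF _ common _ assms _ _ dec, simplified]
  show "n 8 \<le> n 9" "n 1 \<le> n 8" "n 2 \<le> n 1" "n 3 \<le> n 2" "n 4 \<le> n 3" "n 5 \<le> n 4" "n 6 \<le> n 5" "n 7 \<le> n 6"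
    using dom(1,2) dom(3)[of 1] dom(3)[of 2] dom(3)[of 3] dom(3)[of 4] dom(3)[of 5] dom(3)[of 6]
    by (simp_all flip: numeral_2_eq_2)
  show "n 1 - n 7 + n 8 + n 9 \<le> csum 9 n" using dom(4) by simp
  \<comment> \<open>The reached point minus w is 8 (3,3,3,3,3,-4,-4,3,3), whose pairing with n is
    -56 times the displayed sum. The reflection in this vector does not preserve the lattice, so
    only the image of w is compared.\<close>
  show "n 9 + n 8 + n 1 + n 2 + n 3 + n 4 + n 5 + 3 * n 6 + 3 * n 7 \<ge> 0"
    using assms[OF reachable_9(1)] unfolding lform_def sum_expand by (simp add: coords_apply)
  \<comment> \<open>Here the difference is 8 (4,4,4,4,-3,-3,-3,4,4), again with factor -56.\<close>
  show "n 9 + n 8 + n 1 + n 2 + n 3 + n 4 + 3 * n 5 + 3 * n 6 + 3 * n 7 \<ge> 0"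
    using assms[OF reachable_9(2)] unfolding lform_def sum_expand by (simp add: coords_apply)
qed


text \<open>The point whose pairings with the simple roots have absolute value 2, as for rho = 9,
  would be w / 2, which is not integral.\<close>

lemma reachable_10:
  "coords [33, 31, 29, 27, 25, 23, -43, -45, 35, 37]
      \<in> reachable (Gamma_gens 10) (coords [9, 7, 5, 3, 1, -1, -3, -5, 11, 13])" (is ?first)
  "coords [49, 47, 45, 43, -23, -25, -27, -29, 51, 53]
      \<in> reachable (Gamma_gens 10) (coords [9, 7, 5, 3, 1, -1, -3, -5, 11, 13])" (is ?second)
proof -
  let ?P1 = "coords [1, 1, 1, 1, 0, 0, -1, -1, 1, 1]" and ?P2 = "coords [1, 1, 1, 1, 2, 2, -1, -3, 1, 3]"
  have common: "gens_common 10 \<subseteq> Gamma_gens 10" by (simp add: Gamma_gens_def)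
  have gens: "phi 10 ?P1 ?P2 \<in> Gamma_gens 10" "phi 10 ?P1 (Evec 10) \<in> Gamma_gens 10"
    by (simp_all add: Gamma_gens_def gens_extra_def Let_def)
  have "phi 10 ?P1 ?P2 (coords [9, 7, 5, 3, 1, -1, -3, -5, 11, 13])
      = coords [37, 39, 41, 43, 23, 25, -43, -65, 35, 57]"
    by (subst phi_coords[OF _ _ _ refl refl]) (simp_all add: lform_coords)
  moreover have "fold letter [1, 2, 1, 3, 2, 1, 4, 3, 2, 1, 6, 9, 2, 1, 3, 2, 4, 3, 9, 2, 1] [37, 39, 41, 43, 23, 25, -43, -65, 35, 57] =
      [33, 31, 29, 27, 25, 23, -43, -45, 35, 37]"
    by (simp add: letter_def swap_list_def refl_u_list_def Let_def)
  ultimately show 1: ?first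
    using reachable_fold_letter[OF _ common,
        of "[37, 39, 41, 43, 23, 25, -43, -65, 35, 57]"
        _ "[1, 2, 1, 3, 2, 1, 4, 3, 2, 1, 6, 9, 2, 1, 3, 2, 4, 3, 9, 2, 1]"]
      reach_step[OF reach_refl gens(1), of "coords [9, 7, 5, 3, 1, -1, -3, -5, 11, 13]"]
    by simp
  have "phi 10 ?P1 (Evec 10) (coords [33, 31, 29, 27, 25, 23, -43, -45, 35, 37])
      = coords [47, 49, 51, 53, -25, -23, -37, -35, 69, 67]"
    unfolding Evec_coords by (subst phi_coords[OF _ _ _ refl refl]) (simp_all add: lform_coords)
  moreover have "fold letter [0, 2, 3, 2, 4, 3, 2, 6, 8, 9, 2, 3, 4, 8, 9, 2, 3] [47, 49, 51, 53, -25, -23, -37, -35, 69, 67] =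
      [49, 47, 45, 43, -23, -25, -27, -29, 51, 53]"
    by (simp add: letter_def swap_list_def refl_u_list_def Let_def)
  ultimately show ?second
    using reachable_fold_letter[OF _ common,
        of "[47, 49, 51, 53, -25, -23, -37, -35, 69, 67]"
        _ "[0, 2, 3, 2, 4, 3, 2, 6, 8, 9, 2, 3, 4, 8, 9, 2, 3]"]
      reach_step[OF 1 gens(2)]
    by simp
qed

lemma minimal_10:
  assumes "\<And>w'. w'
      \<in> reachable (Gamma_gens 10) (coords [9, 7, 5, 3, 1, -1, -3, -5, 11, 13]) \<Longrightarrow>
      lform 10 w' n \<le> lform 10 (coords [9, 7, 5, 3, 1, -1, -3, -5, 11, 13]) n"
  shows "n 9 \<le> n 10" "n 1 \<le> n 9" "n 2 \<le> n 1" "n 3 \<le> n 2"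
      "n 4 \<le> n 3" "n 5 \<le> n 4" "n 6 \<le> n 5" "n 7 \<le> n 6" "n 8 \<le> n 7"
    "n 1 - n 8 + n 9 + n 10 \<le> csum 10 n"
    "n 10 + n 9 + n 1 + n 2 + n 3 + n 4 + n 5 + n 6 + 3 * n 7 + 3 * n 8 \<ge> 0"
    "n 10 + n 9 + n 1 + n 2 + n 3 + n 4 + 3 * n 5 + 3 * n 6 + 3 * n 7 + 3 * n 8 \<ge> 0"
    "n 10 + n 9 + n 1 + n 2 + n 3 + n 4 + n 5 + 3 * n 6 + 3 * n 7 + 3 * n 8 \<ge> 0"
proof -
  have common: "gens_common 10 \<subseteq> Gamma_gens 10" by (simp add: Gamma_gens_def)
  have dec: "\<forall>i<10 - 3. ([9, 7, 5, 3, 1, -1, -3, -5, 11, 13] :: real list) ! Suc i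
      < [9, 7, 5, 3, 1, -1, -3, -5, 11, 13] ! i"
    by (simp add: numeral_eq_Suc All_less_Suc)
  note dom = minimal_dominant[OF _ common _ assms _ _ dec, simplified]
  show "n 9 \<le> n 10" "n 1 \<le> n 9" "n 2 \<le> n 1" "n 3 \<le> n 2"
      "n 4 \<le> n 3" "n 5 \<le> n 4" "n 6 \<le> n 5" "n 7 \<le> n 6" "n 8 \<le> n 7"
    using dom(1,2) dom(3)[of 1] dom(3)[of 2] dom(3)[of 3] dom(3)[of 4] dom(3)[of 5] dom(3)[of 6] dom(3)[of 7]
    by (simp_all flip: numeral_2_eq_2)
  show "n 1 - n 8 + n 9 + n 10 \<le> csum 10 n" using dom(4) by simp
  \<comment> \<open>The difference from w is 8 (3,3,3,3,3,3,-5,-5,3,3), with factor -64; for the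
    next inequality it is 8 (5,5,5,5,-3,-3,-3,-3,5,5), with the same factor.\<close>
  show "n 10 + n 9 + n 1 + n 2 + n 3 + n 4 + n 5 + n 6 + 3 * n 7 + 3 * n 8 \<ge> 0"
    using assms[OF reachable_10(1)] unfolding lform_def sum_expand by (simp add: coords_apply)
  show "n 10 + n 9 + n 1 + n 2 + n 3 + n 4 + 3 * n 5 + 3 * n 6 + 3 * n 7 + 3 * n 8 \<ge> 0"
    using assms[OF reachable_10(2)] unfolding lform_def sum_expand by (simp add: coords_apply)
  let ?r = "coords [1, 1, 1, 1, 1, -1, -1, -1, 1, 1]"
  have "reflection 10 ?r (coords [9, 7, 5, 3, 1, -1, -3, -5, 11, 13])
      \<in> reachable (Gamma_gens 10) (coords [9, 7, 5, 3, 1, -1, -3, -5, 11, 13])"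
    by (rule reach_step[OF reach_refl]) (simp add: Gamma_gens_def gens_extra_def Let_def)
  moreover have "lform 10 ?r ?r = 4"
    "lform 10 ?r (coords [9, 7, 5, 3, 1, -1, -3, -5, 11, 13]) < 0"
    by (simp_all add: lform_coords)
  ultimately have "lform 10 ?r n \<le> 0" using reachable_reflection_sign assms by blast
  then show "n 10 + n 9 + n 1 + n 2 + n 3 + n 4 + n 5 + 3 * n 6 + 3 * n 7 + 3 * n 8 \<ge> 0"
    unfolding lform_def sum_expand by (simp add: coords_apply)
qed


theorem theorem5p4:
  fixes \<rho> :: nat
  assumes "\<rho> \<in> {4, 5, 6, 7, 8, 9, 10}"
  shows "K' \<rho> = K \<rho>
    \<and> (\<forall>n\<in>E1_star \<rho>. \<forall>m\<in>E1_star \<rho>. n \<noteq> m \<longrightarrow> open_side \<rho> n \<inter> open_side \<rho> m = {})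
    \<and> \<not> (\<exists>n\<in>coord_space \<rho>. lform \<rho> n n > 0 \<and>
           (\<forall>m\<in>E1_star \<rho>. open_side \<rho> n \<inter> open_side \<rho> m = {}))
    \<and> (\<forall>n\<in>E1_star \<rho>. \<exists>C\<subseteq>E1_star \<rho>. card C = \<rho> \<and> n \<in> C \<and>
           (\<forall>a\<in>C. \<forall>b\<in>C. a \<noteq> b \<longrightarrow> lform \<rho> a b = - 1))"
proof -
  \<comment> \<open>Up to rho = 8 any integral point strictly inside K and the chamber serves as w;
    the entries rho, ..., 1 along the order of the simple roots do.\<close>
  have "packing_property 4"
  proof (rule packing_small[where ws = "[2, 1, 3, 4]"])
    show "inner_point 4 (coords [2, 1, 3, 4])"
      by (rule inner_point_coords) simp_all
    show "\<forall>i<4 - 3. ([2, 1, 3, 4] :: real list) ! Suc i < [2, 1, 3, 4] ! i"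
      by (simp add: numeral_eq_Suc All_less_Suc)
    fix n :: "nat \<Rightarrow> real"
    assume "n (4 - 1) \<le> n 4" "n 1 \<le> n (4 - 1)"
      and sorted: "\<And>i. i \<in> {1..4 - 3} \<Longrightarrow> n (i + 1) \<le> n i"
      and "n 1 - n (4 - 2) + n (4 - 1) + n 4 \<le> csum 4 n" "2 * n 4 \<le> csum 4 n"
    then show "2 * sqsum 4 n \<le> (csum 4 n)\<^sup>2"
      using sorted[of 1]
      unfolding csum_def sqsum_def sum_expand by (intro cone_ineq_4) (simp_all flip: numeral_2_eq_2)
  qed simp_all
  moreover have "packing_property 5"
  proof (rule packing_small[where ws = "[3, 2, 1, 4, 5]"])
    show "inner_point 5 (coords [3, 2, 1, 4, 5])"
      by (rule inner_point_coords) simp_all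
    show "\<forall>i<5 - 3. ([3, 2, 1, 4, 5] :: real list) ! Suc i < [3, 2, 1, 4, 5] ! i"
      by (simp add: numeral_eq_Suc All_less_Suc)
    fix n :: "nat \<Rightarrow> real"
    assume "n (5 - 1) \<le> n 5" "n 1 \<le> n (5 - 1)"
      and sorted: "\<And>i. i \<in> {1..5 - 3} \<Longrightarrow> n (i + 1) \<le> n i"
      and "n 1 - n (5 - 2) + n (5 - 1) + n 5 \<le> csum 5 n" "2 * n 5 \<le> csum 5 n"
    then show "2 * sqsum 5 n \<le> (csum 5 n)\<^sup>2"
      using sorted[of 1] sorted[of 2]
      unfolding csum_def sqsum_def sum_expand by (intro cone_ineq_5) (simp_all flip: numeral_2_eq_2)
  qed simp_all
  moreover have "packing_property 6"
  proof (rule packing_small[where ws = "[4, 3, 2, 1, 5, 6]"])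
    show "inner_point 6 (coords [4, 3, 2, 1, 5, 6])"
      by (rule inner_point_coords) simp_all
    show "\<forall>i<6 - 3. ([4, 3, 2, 1, 5, 6] :: real list) ! Suc i < [4, 3, 2, 1, 5, 6] ! i"
      by (simp add: numeral_eq_Suc All_less_Suc)
    fix n :: "nat \<Rightarrow> real"
    assume "n (6 - 1) \<le> n 6" "n 1 \<le> n (6 - 1)"
      and sorted: "\<And>i. i \<in> {1..6 - 3} \<Longrightarrow> n (i + 1) \<le> n i"
      and "n 1 - n (6 - 2) + n (6 - 1) + n 6 \<le> csum 6 n" "2 * n 6 \<le> csum 6 n"
    then show "2 * sqsum 6 n \<le> (csum 6 n)\<^sup>2"
      using sorted[of 1] sorted[of 2] sorted[of 3]
      unfolding csum_def sqsum_def sum_expand by (intro cone_ineq_6) (simp_all flip: numeral_2_eq_2)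
  qed simp_all
  moreover have "packing_property 7"
  proof (rule packing_small[where ws = "[5, 4, 3, 2, 1, 6, 7]"])
    show "inner_point 7 (coords [5, 4, 3, 2, 1, 6, 7])"
      by (rule inner_point_coords) simp_all
    show "\<forall>i<7 - 3. ([5, 4, 3, 2, 1, 6, 7] :: real list) ! Suc i < [5, 4, 3, 2, 1, 6, 7] ! i"
      by (simp add: numeral_eq_Suc All_less_Suc)
    fix n :: "nat \<Rightarrow> real"
    assume "n (7 - 1) \<le> n 7" "n 1 \<le> n (7 - 1)"
      and sorted: "\<And>i. i \<in> {1..7 - 3} \<Longrightarrow> n (i + 1) \<le> n i"
      and "n 1 - n (7 - 2) + n (7 - 1) + n 7 \<le> csum 7 n" "2 * n 7 \<le> csum 7 n"
    then show "2 * sqsum 7 n \<le> (csum 7 n)\<^sup>2"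
      using sorted[of 1] sorted[of 2] sorted[of 3] sorted[of 4]
      unfolding csum_def sqsum_def sum_expand by (intro cone_ineq_7) (simp_all flip: numeral_2_eq_2)
  qed simp_all
  moreover have "packing_property 8"
  proof (rule packing_small[where ws = "[6, 5, 4, 3, 2, 1, 7, 8]"])
    show "inner_point 8 (coords [6, 5, 4, 3, 2, 1, 7, 8])"
      by (rule inner_point_coords) simp_all
    show "\<forall>i<8 - 3. ([6, 5, 4, 3, 2, 1, 7, 8] :: real list) ! Suc i < [6, 5, 4, 3, 2, 1, 7, 8] ! i"
      by (simp add: numeral_eq_Suc All_less_Suc)
    fix n :: "nat \<Rightarrow> real"
    assume "n (8 - 1) \<le> n 8" "n 1 \<le> n (8 - 1)"
      and sorted: "\<And>i. i \<in> {1..8 - 3} \<Longrightarrow> n (i + 1) \<le> n i"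
      and "n 1 - n (8 - 2) + n (8 - 1) + n 8 \<le> csum 8 n" "2 * n 8 \<le> csum 8 n"
    then show "2 * sqsum 8 n \<le> (csum 8 n)\<^sup>2"
      using sorted[of 1] sorted[of 2] sorted[of 3] sorted[of 4] sorted[of 5]
      unfolding csum_def sqsum_def sum_expand by (intro cone_ineq_8) (simp_all flip: numeral_2_eq_2)
  qed simp_all
  moreover have "packing_property 9"
  proof (rule packing_of_orbit)
    show "\<forall>g\<in>Gamma_gens 9. K_symmetry 9 g" using K_symmetry_gens_9 by blast
    show "inner_point 9 (coords [4, 3, 2, 1, 0, -1, -2, 5, 6])" by (rule inner_point_coords) simp_all
    show "coords [4, 3, 2, 1, 0, -1, -2, 5, 6] \<in> lattice 9" by (rule coords_lattice) simp_all
    fix n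
    assume n: "n \<in> E1_star 9" "\<And>w'. w'
        \<in> reachable (Gamma_gens 9) (coords [4, 3, 2, 1, 0, -1, -2, 5, 6]) \<Longrightarrow>
      lform 9 w' n \<le> lform 9 (coords [4, 3, 2, 1, 0, -1, -2, 5, 6]) n"
    show "n = bvec 9"
    proof (rule minimal_eq_bvec[OF _ n(1)])
      assume "2 * n 9 \<le> csum 9 n"
      then show "2 * sqsum 9 n \<le> (csum 9 n)\<^sup>2"
        using minimal_9[OF n(2)] unfolding csum_def sqsum_def sum_expand
        by (intro cone_ineq_9) assumption+
    qed simp
  qed simp
  moreover have "packing_property 10"
  proof (rule packing_of_orbit)
    show "\<forall>g\<in>Gamma_gens 10. K_symmetry 10 g" using K_symmetry_gens_10 by blast
    show "inner_point 10 (coords [9, 7, 5, 3, 1, -1, -3, -5, 11, 13])" by (rule inner_point_coords) simp_all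
    show "coords [9, 7, 5, 3, 1, -1, -3, -5, 11, 13] \<in> lattice 10" by (rule coords_lattice) simp_all
    fix n
    assume n: "n \<in> E1_star 10" "\<And>w'. w'
        \<in> reachable (Gamma_gens 10) (coords [9, 7, 5, 3, 1, -1, -3, -5, 11, 13]) \<Longrightarrow>
      lform 10 w' n \<le> lform 10 (coords [9, 7, 5, 3, 1, -1, -3, -5, 11, 13]) n"
    show "n = bvec 10"
    proof (rule minimal_eq_bvec[OF _ n(1)])
      assume "2 * n 10 \<le> csum 10 n"
      then show "2 * sqsum 10 n \<le> (csum 10 n)\<^sup>2"
        using minimal_10[OF n(2)] unfolding csum_def sqsum_def sum_expand
        by (intro cone_ineq_10) assumption+
    qed simp
  qed simp
  ultimately have "packing_property \<rho>" using assms by auto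
  then show ?thesis unfolding packing_property_def .
qed

end
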